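(* Let $m,n\ge 1$ be integers, let $A$ be an arbitrary real $m\times n$ matrix, and let $\psi:(0,\infty)\to(0,\infty)$ be non-increasing and dyadically regular (i.e. there exist $\varrho\in(0,1)$ and an integer $k_0\ge 0$ with $\psi(2^{k+1})\le\varrho\,\psi(2^k)$ for all $k\ge k_0$). Then \[ \mathcal L^m(W_A(\psi))= \begin{cases} 0 & \text{if } \sum_{k=0}^{\infty} M_A(\psi(2^k),2^k)<\infty,\\ 1 & \text{if } \sum_{k=0}^{\infty} M_A(\psi(2^k),2^k)=\infty. \end{cases} \]
   Context: Norms $|\cdot|$ on $\mathbb R^m,\mathbb R^n$ are supremum norms; $\mathbb T^m=\mathbb R^m/\mathbb Z^m$; $|\mathbf x|_{\mathbb Z^m}:=\min_{\mathbf p\in\mathbb Z^m}|\mathbf x-\mathbf p|$ (well defined also for $\mathbf x\in\mathbb T^m$); $\mathcal L^m$ is normalized Lebesgue measure on $\mathbb T^m$. $W_A(\psi)$ is the set of $\mathbf b\in\mathbb T^m$ such that $|A\mathbf q-\mathbf b|_{\mathbb Z^m}<\psi(|\mathbf q|)$ holds for infinitely many distinct $\mathbf q\in\mathbb Z^n\setminus\{\mathbf 0\}$. For $r,T>0$, \[ N_A(r,T):=\#\{(\mathbf p,\mathbf q)\in\mathbb Z^m\times\mathbb Z^n: |A\mathbf q-\mathbf p|\le r,\ |\mathbf q|\le T\},\qquad M_A(r,T):=\frac{r^mT^n}{N_A(r,T)}. \] The zero vector is counted in $N_A(r,T)$. *)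

theory Defs
  imports "HOL-Analysis.Analysis"
begin

text \<open>The supremum norm on \<open>real ^ 'm\<close> is the library's \<^const>\<open>infnorm\<close>; \<^const>\<open>norm\<close> is
  the Euclidean norm and is not used.\<close>

definition int_lattice :: "(real ^ 'm) set" where
  "int_lattice = {p. \<forall>i. p $ i \<in> \<int>}"

lemma int_lattice_simps [simp]:
  "0 \<in> int_lattice" "- p \<in> int_lattice \<longleftrightarrow> p \<in> int_lattice"
  by (auto simp: int_lattice_def)

lemma int_lattice_add: "p \<in> int_lattice \<Longrightarrow> q \<in> int_lattice \<Longrightarrow> p + q \<in> int_lattice"
  by (auto simp: int_lattice_def)

lemma int_lattice_diff: "p \<in> int_lattice \<Longrightarrow> q \<in> int_lattice \<Longrightarrow> p - q \<in> int_lattice"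
  by (auto simp: int_lattice_def)

text \<open>The distance \<open>|x|\<close> to the integer lattice. The infimum is a minimum:
  see \<open>lattice_norm_attained\<close>.\<close>

definition lattice_norm :: "real ^ 'm \<Rightarrow> real" where
  "lattice_norm x = (INF p\<in>int_lattice. infnorm (x - p))"

lemma infnorm_le_iff: "infnorm (x :: real ^ 'm) \<le> c \<longleftrightarrow> (\<forall>i. \<bar>x $ i\<bar> \<le> c)"
proof -
  have "{\<bar>x $ i\<bar> |i. i \<in> UNIV} = range (\<lambda>i. \<bar>x $ i\<bar>)" by auto
  then show ?thesis
    by (simp add: infnorm_cart cSup_le_iff)
qed

lemma lattice_norm_attained: "\<exists>p\<in>int_lattice. lattice_norm x = infnorm (x - p)"
proof -
  define p where "p = (\<chi> i. real_of_int (round (x $ i)))"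
  have p: "p \<in> int_lattice" by (auto simp: p_def int_lattice_def)
  have le: "infnorm (x - p) \<le> infnorm (x - q)" if "q \<in> int_lattice" for q
    unfolding infnorm_le_iff[of "x - p"]
  proof
    fix i
    from that obtain z where z: "q $ i = of_int z" by (auto simp: int_lattice_def Ints_def)
    have "\<bar>(x - p) $ i\<bar> = \<bar>x $ i - of_int (round (x $ i))\<bar>" by (simp add: p_def)
    also have "\<dots> \<le> \<bar>x $ i - of_int z\<bar>" by (rule round_diff_minimal)
    also have "\<dots> = \<bar>(x - q) $ i\<bar>" by (simp add: z)
    also have "\<dots> \<le> infnorm (x - q)" by (rule component_le_infnorm_cart)
    finally show "\<bar>(x - p) $ i\<bar> \<le> infnorm (x - q)" .
  qed
  have "lattice_norm x = infnorm (x - p)"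
    unfolding lattice_norm_def using p le by (intro cInf_eq_minimum) auto
  with p show ?thesis by blast
qed

lemma lattice_norm_periodic:
  assumes "p \<in> int_lattice" shows "lattice_norm (x + p) = lattice_norm x"
proof -
  have "(\<lambda>q. infnorm (x + p - q)) ` int_lattice = (\<lambda>q. infnorm (x - q)) ` int_lattice"
  proof (intro equalityI subsetI; elim imageE)
    fix y q assume "y = infnorm (x + p - q)" "q \<in> int_lattice"
    then show "y \<in> (\<lambda>q. infnorm (x - q)) ` int_lattice"
      using assms by (intro image_eqI[of _ _ "q - p"]) (auto intro: int_lattice_diff simp: algebra_simps)
  next
    fix y q assume "y = infnorm (x - q)" "q \<in> int_lattice"
    then show "y \<in> (\<lambda>q. infnorm (x + p - q)) ` int_lattice"
      using assms by (intro image_eqI[of _ _ "q + p"]) (auto intro: int_lattice_add)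
  qed
  then show ?thesis by (simp add: lattice_norm_def)
qed

definition torus_rel :: "((real ^ 'm) \<times> (real ^ 'm)) set" where
  "torus_rel = {(x, y). x - y \<in> int_lattice}"

definition torus :: "(real ^ 'm) set set" where
  "torus = UNIV // torus_rel"

definition torus_class :: "real ^ 'm \<Rightarrow> (real ^ 'm) set" where
  "torus_class x = torus_rel `` {x}"

lemma equiv_torus_rel: "equiv UNIV (torus_rel :: ((real ^ 'm) \<times> (real ^ 'm)) set)"
proof (rule equivI)
  show "sym (torus_rel :: ((real ^ 'm) \<times> (real ^ 'm)) set)"
  proof (rule symI)
    fix x y :: "real ^ 'm"
    assume "(x, y) \<in> torus_rel"
    then show "(y, x) \<in> torus_rel"
      using int_lattice_simps(2)[of "x - y"] by (simp add: torus_rel_def)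
  qed
  show "trans (torus_rel :: ((real ^ 'm) \<times> (real ^ 'm)) set)"
  proof (rule transI)
    fix x y z :: "real ^ 'm"
    assume "(x, y) \<in> torus_rel" "(y, z) \<in> torus_rel"
    then show "(x, z) \<in> torus_rel"
      using int_lattice_add[of "x - y" "y - z"] by (simp add: torus_rel_def)
  qed
qed (auto simp: refl_on_def torus_rel_def)

lemma torus_class_in_torus [simp]: "torus_class x \<in> torus"
  by (simp add: torus_class_def torus_def quotientI)

lemma torus_class_eq_iff: "torus_class x = torus_class y \<longleftrightarrow> x - y \<in> int_lattice"
  using eq_equiv_class_iff[OF equiv_torus_rel, of x y]
  by (simp add: torus_class_def) (simp add: torus_rel_def)

text \<open>Lebesgue measure on the torus: a set is measurable iff its preimage under the projection
  is Lebesgue measurable, and the measure is the image of Lebesgue measure on the unit cube.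
  The closed cube serves as fundamental domain, as its overlapping faces are null sets.\<close>

definition torus_measure :: "(real ^ 'm) set measure" where
  "torus_measure =
     distr (lebesgue_on (cbox 0 1))
       (sigma torus {B. B \<subseteq> torus \<and> torus_class -` B \<in> sets lebesgue}) torus_class"

lemma sigma_algebra_torus:
  "sigma_algebra torus {B :: (real ^ 'm) set set. B \<subseteq> torus \<and> torus_class -` B \<in> sets lebesgue}"
proof -
  have *: "torus_class -` (torus - B) \<in> sets lebesgue" if "torus_class -` B \<in> sets lebesgue"
    for B :: "(real ^ 'm) set set"
  proof -
    have "torus_class -` (torus - B) = space lebesgue - torus_class -` B" by auto
    then show ?thesis using that by (metis sets.compl_sets)
  qed
  show ?thesis
    unfolding sigma_algebra_iff2
    using * by (auto simp: vimage_UN)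
qed

lemma sets_torus_measure:
  "sets torus_measure = {B. B \<subseteq> torus \<and> torus_class -` B \<in> sets lebesgue}"
  unfolding torus_measure_def sets_distr
  by (subst sets_measure_of) (auto intro!: sigma_algebra.sigma_sets_eq sigma_algebra_torus)

lemma space_torus_measure: "space torus_measure = torus"
  unfolding torus_measure_def space_distr by (subst space_measure_of) auto

lemma torus_class_measurable:
  "torus_class \<in> measurable (lebesgue_on (cbox 0 1))
     (sigma torus {B. B \<subseteq> torus \<and> torus_class -` B \<in> sets lebesgue})"
  by (rule measurable_measure_of)
    (auto simp: sets_restrict_space space_restrict_space Int_commute)

lemma emeasure_torus_measure:
  assumes "B \<in> sets torus_measure"
  shows "emeasure torus_measure B = emeasure lebesgue (torus_class -` B \<inter> cbox 0 1)"
proof -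
  have "B \<in> sets (sigma torus {B. B \<subseteq> torus \<and> torus_class -` B \<in> sets lebesgue})"
    using assms by (simp add: torus_measure_def)
  then show ?thesis
    unfolding torus_measure_def
    by (subst emeasure_distr[OF torus_class_measurable])
      (auto simp: space_restrict_space intro!: emeasure_restrict_space)
qed

lemma emeasure_torus: "emeasure torus_measure (torus :: (real ^ 'm) set set) = 1"
proof -
  have "(torus :: (real ^ 'm) set set) \<in> sets torus_measure"
    using sets.top[of torus_measure] by (simp add: space_torus_measure)
  moreover have "torus_class -` torus = (UNIV :: (real ^ 'm) set)" by auto
  moreover have "emeasure lborel (cbox (0 :: real ^ 'm) 1) = 1"
  proof -
    have "cbox (0 :: real ^ 'm) 1 \<noteq> {}" by (auto simp: interval_ne_empty_cart)
    then have "measure lborel (cbox (0 :: real ^ 'm) 1) = 1" by (simp add: content_cbox_cart)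
    moreover have "emeasure lborel (cbox (0 :: real ^ 'm) 1) \<noteq> \<infinity>"
      using emeasure_lborel_cbox_finite[of "0 :: real ^ 'm" 1] by auto
    ultimately show ?thesis by (simp add: emeasure_eq_ennreal_measure)
  qed
  ultimately show ?thesis by (simp add: emeasure_torus_measure)
qed

text \<open>The condition on a representative \<open>b\<close> depends only on its class:
  see \<open>torus_class_in_W_iff\<close>.\<close>

definition W :: "real ^ 'n ^ 'm \<Rightarrow> (real \<Rightarrow> real) \<Rightarrow> (real ^ 'm) set set" where
  "W A \<psi> = torus_class `
     {b. infinite {q \<in> int_lattice - {0}. lattice_norm (A *v q - b) < \<psi> (infnorm q)}}"

lemma torus_class_in_W_iff:
  "torus_class b \<in> W A \<psi> \<longleftrightarrow>
     infinite {q \<in> int_lattice - {0}. lattice_norm (A *v q - b) < \<psi> (infnorm q)}"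
proof -
  let ?P = "\<lambda>b. infinite {q \<in> int_lattice - {0}. lattice_norm (A *v q - b) < \<psi> (infnorm q)}"
  have "?P b = ?P c" if "torus_class b = torus_class c" for c
  proof -
    have "lattice_norm (A *v q - b) = lattice_norm (A *v q - c)" for q
      using lattice_norm_periodic[of "b - c" "A *v q - b"] that
      by (simp add: torus_class_eq_iff algebra_simps)
    then show ?thesis by (simp only:)
  qed
  then show ?thesis unfolding W_def by blast
qed

definition N :: "real ^ 'n ^ 'm \<Rightarrow> real \<Rightarrow> real \<Rightarrow> nat" where
  "N A r T = card {(p, q). p \<in> int_lattice \<and> q \<in> int_lattice \<and>
     infnorm (A *v q - p) \<le> r \<and> infnorm q \<le> T}"

definition M :: "real ^ 'n ^ 'm \<Rightarrow> real \<Rightarrow> real \<Rightarrow> real" where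
  "M A r T = r ^ CARD('m) * T ^ CARD('n) / real (N A r T)"

text \<open>The set counted by \<^const>\<open>N\<close> is finite, so \<^const>\<open>card\<close> is its true cardinality.\<close>

lemma finite_int_lattice_ball: "finite {q \<in> int_lattice. infnorm (q :: real ^ 'm) \<le> c}"
proof -
  have fin: "finite {x \<in> \<int>. \<bar>x\<bar> \<le> c}" for c :: real
    by (rule finite_abs_int_segment)
  have "finite {f :: 'm \<Rightarrow> real. \<forall>i. f i \<in> {x \<in> \<int>. \<bar>x\<bar> \<le> c}}"
    using finite_PiE[of "UNIV :: 'm set" "\<lambda>_. {x \<in> \<int>. \<bar>x\<bar> \<le> c}"] fin
    by (simp add: PiE_UNIV_domain Pi_def)
  then have "finite (vec_lambda ` {f :: 'm \<Rightarrow> real. \<forall>i. f i \<in> {x \<in> \<int>. \<bar>x\<bar> \<le> c}})"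
    by (rule finite_imageI)
  then show ?thesis
  proof (rule rev_finite_subset, intro subsetI)
    fix q :: "real ^ 'm"
    assume "q \<in> {q \<in> int_lattice. infnorm q \<le> c}"
    then show "q \<in> vec_lambda ` {f. \<forall>i. f i \<in> {x \<in> \<int>. \<bar>x\<bar> \<le> c}}"
      by (intro image_eqI[of _ _ "vec_nth q"]) (auto simp: int_lattice_def infnorm_le_iff)
  qed
qed

lemma finite_N:
  "finite {(p, q). p \<in> int_lattice \<and> q \<in> int_lattice \<and>
     infnorm ((A :: real ^ 'n ^ 'm) *v q - p) \<le> r \<and> infnorm q \<le> T}"
proof (rule finite_subset)
  let ?Q = "{q \<in> int_lattice. infnorm (q :: real ^ 'n) \<le> T}"
  let ?P = "\<lambda>q. {p \<in> int_lattice. infnorm p \<le> r + infnorm (A *v q)}"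
  show "finite ((\<lambda>(q, p). (p, q)) ` (SIGMA q:?Q. ?P q))"
    by (intro finite_imageI finite_SigmaI finite_int_lattice_ball)
  have le: "infnorm p \<le> r + infnorm (A *v q)" if "infnorm (A *v q - p) \<le> r" for p q
    using infnorm_triangle[of "p - A *v q" "A *v q"] that infnorm_sub[of p "A *v q"] by simp
  show "{(p, q). p \<in> int_lattice \<and> q \<in> int_lattice \<and> infnorm (A *v q - p) \<le> r \<and> infnorm q \<le> T}
      \<subseteq> (\<lambda>(q, p). (p, q)) ` (SIGMA q:?Q. ?P q)"
  proof (rule subsetI)
    fix z
    assume "z \<in> {(p, q). p \<in> int_lattice \<and> q \<in> int_lattice \<and> infnorm (A *v q - p) \<le> r \<and> infnorm q \<le> T}"
    then obtain p q where "z = (p, q)" "p \<in> int_lattice" "q \<in> int_lattice"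
      "infnorm (A *v q - p) \<le> r" "infnorm q \<le> T" by blast
    with le[of q p] show "z \<in> (\<lambda>(q, p). (p, q)) ` (SIGMA q:?Q. ?P q)"
      by (intro image_eqI[of _ _ "(q, p)"]) simp_all
  qed
qed

definition dyadically_regular :: "(real \<Rightarrow> real) \<Rightarrow> bool" where
  "dyadically_regular \<psi> \<longleftrightarrow>
     (\<exists>\<rho>. 0 < \<rho> \<and> \<rho> < 1 \<and> (\<exists>k0::nat. \<forall>k\<ge>k0. \<psi> (2 ^ (k + 1)) \<le> \<rho> * \<psi> (2 ^ k)))"

end

theory Submission
  imports Defs
begin

text \<open>Let \<open>E k\<close> be the set of points within \<open>r k = \<psi> (2 ^ k)\<close> of some \<open>A q\<close> modulo 1 with
  \<open>|q| \<le> T k = 2 ^ k\<close>. Each of the roughly \<open>(T k) ^ n\<close> balls overlaps about \<open>N A (r k) (T k)\<close> others,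
  so \<open>E k\<close> has measure comparable to \<open>M A (r k) (T k)\<close>, and Borel--Cantelli settles convergence.

  For divergence, a second moment computation gives, for \<open>k \<le> l\<close>, a bound of the order of
  \<open>M A (r k) (T k) * M A (r l) (T l) / M A (r k) (T l)\<close> for the correlation of \<open>E k\<close> and \<open>E l\<close>. If the
  lattice vectors \<open>(A q - p, q)\<close> in the box of size \<open>(r k, T l)\<close> span, then \<open>M A (r k) (T l)\<close> is bounded
  below and the pair is quasi-independent. Otherwise they lie in a hyperplane, and shrinking the box
  by \<open>K\<close> shrinks \<open>M\<close> by a factor of order \<open>K\<close>; dyadic regularity then makes
  \<open>M A (r s) (T s) / M A (r k) (T l)\<close> exponentially small in the distance of \<open>s\<close> to \<open>{k, l}\<close>, so that such pairs contribute only
  \<open>O(\<Sum>k. M A (r k) (T k))\<close>. Hence the limit superior of the \<open>E k\<close> has positive measure. The same dichotomy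
  shows that divergence forces the points \<open>A q - p\<close> to be dense, so the union of the translates of the
  limit superior by these points has full measure. Halving \<open>r\<close> and \<open>T\<close> beforehand absorbs the translations.\<close>

section \<open>Bounded sums of correlations\<close>

lemma sum_power_less_le:
  fixes \<sigma> :: real
  assumes "0 \<le> \<sigma>" "\<sigma> < 1"
  shows "(\<Sum>i<j. \<sigma> ^ i) \<le> 1 / (1 - \<sigma>)"
proof -
  have "(\<Sum>i<j. \<sigma> ^ i) = (1 - \<sigma> ^ j) / (1 - \<sigma>)"
    using assms by (simp add: sum_gp_strict)
  also have "\<dots> \<le> 1 / (1 - \<sigma>)" using assms by (intro divide_right_mono) auto
  finally show ?thesis .
qed

lemma sum_power_min_le:
  fixes \<sigma> :: real
  assumes \<sigma>: "0 \<le> \<sigma>" "\<sigma> < 1"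
  shows "(\<Sum>i<j. \<sigma> ^ min i (j - i)) \<le> 2 / (1 - \<sigma>)"
proof -
  \<comment> \<open>Weakening the exponent \<open>j - i\<close> to \<open>j - Suc i\<close> makes
    the second sum the reversal of the first.\<close>
  have "(\<Sum>i<j. \<sigma> ^ min i (j - i)) \<le> (\<Sum>i<j. \<sigma> ^ i + \<sigma> ^ (j - Suc i))"
  proof (rule sum_mono)
    fix i
    have "\<sigma> ^ (j - i) \<le> \<sigma> ^ (j - Suc i)" using \<sigma> by (intro power_decreasing) auto
    moreover have "0 \<le> \<sigma> ^ i" "0 \<le> \<sigma> ^ (j - Suc i)" using \<sigma> by auto
    ultimately show "\<sigma> ^ min i (j - i) \<le> \<sigma> ^ i + \<sigma> ^ (j - Suc i)"
      by (auto simp: min_def)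
  qed
  also have "\<dots> = 2 * (\<Sum>i<j. \<sigma> ^ i)"
    by (simp add: sum.distrib sum.nat_diff_reindex)
  also have "\<dots> \<le> 2 * (1 / (1 - \<sigma>))" by (intro mult_left_mono sum_power_less_le \<sigma>) auto
  finally show ?thesis by simp
qed

text \<open>The partial sums \<open>X j\<close> of \<open>x\<close> satisfy \<open>a j = O(1 / (1 + X j)\<^sup>2)\<close>, so the series telescopes.\<close>

lemma sum_mult_le_of_decay:
  fixes x a :: "nat \<Rightarrow> real"
  assumes \<sigma>: "0 \<le> \<sigma>" "\<sigma> < 1" and x: "\<And>j. 0 \<le> x j" "\<And>j. x j \<le> 1"
    and a: "\<And>j. 0 \<le> a j" "\<And>j. a j \<le> C"
    and decay: "\<And>i j. i \<le> j \<Longrightarrow> a j * x i \<le> C * (\<sigma> ^ 2) ^ min i (j - i)"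
  shows "(\<Sum>j<n. a j * x j) \<le> 4 * C + 16 * C / (1 - \<sigma>) ^ 2"
proof -
  have C: "0 \<le> C" using a[of 0] by linarith
  define X where "X = (\<lambda>j. \<Sum>i<j. x i)"
  \<comment> \<open>Twice the sum of the bounds \<open>C\<close> for \<open>a j\<close> and
    \<open>4 * C / (1 - \<sigma>) ^ 2\<close> for \<open>a j * X j ^ 2\<close>; the doubling comes
    from \<open>(1 + X j) ^ 2 \<le> 2 + 2 * X j ^ 2\<close>.\<close>
  define F where "F = 2 * C + 8 * C / (1 - \<sigma>) ^ 2"
  have X0: "0 \<le> X j" for j unfolding X_def by (intro sum_nonneg x)
  have aX: "a j * (1 + X j) ^ 2 \<le> F" for j
  proof -
    have "sqrt (a j) * X j = (\<Sum>i<j. sqrt (a j) * x i)" by (simp add: X_def sum_distrib_left)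
    also have "\<dots> \<le> (\<Sum>i<j. sqrt C * \<sigma> ^ min i (j - i))"
    proof (rule sum_mono)
      fix i assume "i \<in> {..<j}"
      then have "i \<le> j" by simp
      \<comment> \<open>Replacing \<open>x i\<close> by its larger square root lets the decay of
        \<open>a j * x i\<close> be used term by term. The square root halves the exponent, hence
        the rate \<open>\<sigma> ^ 2\<close> in the hypothesis.\<close>
      have "x i \<le> sqrt (x i)" using x by (intro real_le_rsqrt) (simp add: power2_eq_square mult_left_le)
      then have "sqrt (a j) * x i \<le> sqrt (a j * x i)"
        using a by (simp add: real_sqrt_mult mult_left_mono)
      also have "\<dots> \<le> sqrt (C * (\<sigma> ^ 2) ^ min i (j - i))" using decay[OF \<open>i \<le> j\<close>] by simp
      also have "\<dots> = sqrt C * \<sigma> ^ min i (j - i)"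
        using \<sigma> by (simp add: real_sqrt_mult real_sqrt_power)
      finally show "sqrt (a j) * x i \<le> sqrt C * \<sigma> ^ min i (j - i)" .
    qed
    also have "\<dots> \<le> sqrt C * (2 / (1 - \<sigma>))"
      unfolding sum_distrib_left[symmetric]
      by (intro mult_left_mono sum_power_min_le \<sigma>) (use C in auto)
    finally have "(sqrt (a j) * X j) ^ 2 \<le> (sqrt C * (2 / (1 - \<sigma>))) ^ 2"
      using a X0 by (intro power_mono) auto
    then have "a j * X j ^ 2 \<le> 4 * C / (1 - \<sigma>) ^ 2"
      using a C by (simp add: power_mult_distrib power_divide mult.commute)
    moreover have "(1 + X j) ^ 2 \<le> 2 + 2 * X j ^ 2"
      using sum_squares_bound[of 1 "X j"] by (simp add: power2_eq_square algebra_simps)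
    then have "a j * (1 + X j) ^ 2 \<le> a j * (2 + 2 * X j ^ 2)"
      using a by (intro mult_left_mono)
    then have "a j * (1 + X j) ^ 2 \<le> 2 * a j + 2 * (a j * X j ^ 2)" by (simp add: algebra_simps)
    ultimately show ?thesis using a(2)[of j] by (simp add: F_def)
  qed
  have F: "0 \<le> F" unfolding F_def using C by simp
  have "(\<Sum>j<n. a j * x j) \<le> (\<Sum>j<n. 2 * F * (1 / (1 + X j) - 1 / (1 + X (Suc j))))"
  proof (rule sum_mono)
    fix j
    have X1: "X (Suc j) = X j + x j" by (simp add: X_def)
    have pos: "0 < 1 + X j" "0 < 1 + X (Suc j)" using X0[of j] X0[of "Suc j"] by linarith+
    \<comment> \<open>As \<open>x j \<le> 1\<close>, consecutive values of \<open>1 + X j\<close>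
      differ by at most a factor 2. One factor of the square can thus be moved to index
      \<open>Suc j\<close>, which turns the quotient into a telescoping difference.\<close>
    have "1 + X (Suc j) \<le> 2 * (1 + X j)" unfolding X1 using x(2)[of j] X0[of j] by simp
    then have "x j / (1 + X j) ^ 2 \<le> x j * 2 / ((1 + X j) * (1 + X (Suc j)))"
    proof -
      have "1 / (1 + X j) \<le> 2 / (1 + X (Suc j))"
        using pos \<open>1 + X (Suc j) \<le> 2 * (1 + X j)\<close> by (simp add: field_simps)
      then have "x j / (1 + X j) * (1 / (1 + X j)) \<le> x j / (1 + X j) * (2 / (1 + X (Suc j)))"
        using pos x[of j] by (intro mult_left_mono) auto
      then show ?thesis by (simp add: power2_eq_square)
    qed
    also have "\<dots> = 2 * (1 / (1 + X j) - 1 / (1 + X (Suc j)))"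
      using pos X1 by (simp add: field_simps)
    finally have "F * (x j / (1 + X j) ^ 2) \<le> F * (2 * (1 / (1 + X j) - 1 / (1 + X (Suc j))))"
      using F by (intro mult_left_mono)
    moreover have "a j * x j \<le> F * (x j / (1 + X j) ^ 2)"
    proof -
      have "a j \<le> F / (1 + X j) ^ 2" using aX[of j] pos by (simp add: field_simps)
      then have "a j * x j \<le> F / (1 + X j) ^ 2 * x j" using x by (intro mult_right_mono)
      then show ?thesis by simp
    qed
    ultimately show "a j * x j \<le> 2 * F * (1 / (1 + X j) - 1 / (1 + X (Suc j)))"
      by (simp add: algebra_simps)
  qed
  also have "\<dots> = 2 * F * (1 - 1 / (1 + X n))"
    using sum_lessThan_telescope'[of "\<lambda>j. 1 / (1 + X j)" n]
    by (simp add: sum_distrib_left[symmetric] X_def[THEN fun_cong, of 0])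
  also have "\<dots> \<le> 2 * F * 1" using F X0[of n] by (intro mult_left_mono) auto
  finally show ?thesis by (simp add: F_def)
qed

text \<open>Here \<open>m k\<close> is the measure of the \<open>k\<close>-th set and \<open>m k * m l / u k l\<close> bounds the measure of
  an intersection. Pairs in \<open>b\<close> need not be quasi-independent; they are summed by fixing the index
  with the larger \<open>m\<close>, where the decay towards the middle of \<open>{k..l}\<close> makes the other index summable.\<close>

lemma sum_correlations_le:
  fixes m :: "nat \<Rightarrow> real" and u :: "nat \<Rightarrow> nat \<Rightarrow> real" and b :: "nat \<Rightarrow> nat \<Rightarrow> bool"
  assumes \<sigma>: "0 \<le> \<sigma>" "\<sigma> < 1" and C: "0 \<le> C" and \<epsilon>: "0 < \<epsilon>"
    and m: "\<And>k. 0 < m k" and u: "\<And>k l. k \<le> l \<Longrightarrow> 0 < u k l"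
    and good: "\<And>k l. k \<le> l \<Longrightarrow> \<not> b k l \<Longrightarrow> \<epsilon> \<le> u k l"
    and bad: "\<And>k s l. k \<le> s \<Longrightarrow> s \<le> l \<Longrightarrow> b k l \<Longrightarrow> m s \<le> C * (\<sigma> ^ 2) ^ min (s - k) (l - s) * u k l"
    and J: "finite J"
  defines "D \<equiv> 4 * C + 16 * C / (1 - \<sigma>) ^ 2"
  shows "(\<Sum>k\<in>J. \<Sum>l\<in>J. m k * m l / u (min k l) (max k l)) \<le> sum m J ^ 2 / \<epsilon> + 4 * D * sum m J"
proof -
  define B where "B = (\<lambda>k l. b (min k l) (max k l))"
  define U where "U = (\<lambda>k l. u (min k l) (max k l))"
  have Bsym: "B k l = B l k" and Usym: "U k l = U l k" for k l
    by (simp_all add: B_def U_def min.commute max.commute)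
  have U: "0 < U k l" for k l unfolding U_def by (intro u) simp
  have mono: "C * (\<sigma> ^ 2) ^ i \<le> C" for i
    using \<sigma> C by (intro mult_left_le) (auto intro!: power_le_one)
  obtain n where n: "\<And>l. l \<in> J \<Longrightarrow> l < n" using J by (metis finite_nat_set_iff_bounded)
  have bound: "a / U k l \<le> c" if "a \<le> c * U k l" for a c k l
    using that U[of k l] by (simp add: divide_le_eq)
  have bad': "m s / U k l \<le> C * (\<sigma> ^ 2) ^ min (s - min k l) (max k l - s)"
    if "min k l \<le> s" "s \<le> max k l" "B k l" for k s l
    using bad[OF that(1,2)] that(3) by (intro bound) (simp add: B_def U_def)
  have right: "(\<Sum>l | l \<in> J \<and> k \<le> l \<and> m l \<le> m k \<and> B k l. m l / U k l) \<le> D" for k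
  proof -
    \<comment> \<open>Division by \<open>m k\<close> makes the weights at most 1. In
      \<open>a j * x i\<close> the factor \<open>m k\<close> cancels and leaves
      \<open>m (k + i) / U k (k + j)\<close>, which \<open>bad\<close> controls at the interior
      index \<open>k + i\<close>; the case \<open>i = 0\<close> bounds \<open>a j\<close>
      itself.\<close>
    define x where "x = (\<lambda>j. if k + j \<in> J \<and> m (k + j) \<le> m k then m (k + j) / m k else 0)"
    define a where "a = (\<lambda>j. if B k (k + j) then m k / U k (k + j) else 0)"
    have "(\<Sum>l | l \<in> J \<and> k \<le> l \<and> m l \<le> m k \<and> B k l. m l / U k l) =
        (\<Sum>j | k + j \<in> J \<and> m (k + j) \<le> m k \<and> B k (k + j). m (k + j) / U k (k + j))"
      by (rule sum.reindex_bij_witness[of _ "\<lambda>j. k + j" "\<lambda>l. l - k"]) auto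
    also have "\<dots> = (\<Sum>j | k + j \<in> J \<and> m (k + j) \<le> m k \<and> B k (k + j). a j * x j)"
      using m less_imp_neq[OF m] by (intro sum.cong) (auto simp: a_def x_def)
    also have "\<dots> = (\<Sum>j<n. a j * x j)"
      by (rule sum.mono_neutral_left) (auto simp: a_def x_def dest!: n)
    also have "\<dots> \<le> D"
      unfolding D_def
    proof (rule sum_mult_le_of_decay[OF \<sigma>])
      fix j
      show "0 \<le> x j" "x j \<le> 1" using m by (auto simp: x_def less_imp_le)
      show "0 \<le> a j" using m U by (auto simp: a_def less_imp_le)
      show "a j \<le> C" using bad'[of k "k + j" k] C by (auto simp: a_def)
    next
      fix i j :: nat assume ij: "i \<le> j"
      show "a j * x i \<le> C * (\<sigma> ^ 2) ^ min i (j - i)"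
        using bad'[of k "k + j" "k + i"] ij C \<sigma> m[of k] by (auto simp: a_def x_def)
    qed
    finally show ?thesis .
  qed
  have left: "(\<Sum>l | l \<in> J \<and> l \<le> k \<and> m l \<le> m k \<and> B k l. m l / U k l) \<le> D" for k
  proof -
    \<comment> \<open>The mirror image, counting downwards from \<open>k\<close>. The guard
      \<open>j \<le> k\<close> stops truncated subtraction from counting the index 0
      repeatedly.\<close>
    define x where "x = (\<lambda>j. if j \<le> k \<and> k - j \<in> J \<and> m (k - j) \<le> m k then m (k - j) / m k else 0)"
    define a where "a = (\<lambda>j. if j \<le> k \<and> B k (k - j) then m k / U k (k - j) else 0)"
    have "(\<Sum>l | l \<in> J \<and> l \<le> k \<and> m l \<le> m k \<and> B k l. m l / U k l) =
        (\<Sum>j | j \<le> k \<and> k - j \<in> J \<and> m (k - j) \<le> m k \<and> B k (k - j). m (k - j) / U k (k - j))"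
      by (rule sum.reindex_bij_witness[of _ "\<lambda>j. k - j" "\<lambda>l. k - l"]) auto
    also have "\<dots> = (\<Sum>j | j \<le> k \<and> k - j \<in> J \<and> m (k - j) \<le> m k \<and> B k (k - j). a j * x j)"
      using m less_imp_neq[OF m] by (intro sum.cong) (auto simp: a_def x_def)
    also have "\<dots> = (\<Sum>j<Suc k. a j * x j)"
      by (rule sum.mono_neutral_left) (auto simp: a_def x_def)
    also have "\<dots> \<le> D"
      unfolding D_def
    proof (rule sum_mult_le_of_decay[OF \<sigma>])
      fix j
      show "0 \<le> x j" "x j \<le> 1" using m by (auto simp: x_def less_imp_le)
      show "0 \<le> a j" using m U by (auto simp: a_def less_imp_le)
      show "a j \<le> C" using bad'[of k "k - j" k] C by (auto simp: a_def)
    next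
      fix i j :: nat assume ij: "i \<le> j"
      show "a j * x i \<le> C * (\<sigma> ^ 2) ^ min i (j - i)"
        using bad'[of k "k - j" "k - i"] ij C \<sigma> m[of k] by (auto simp: a_def x_def min.commute)
    qed
    finally show ?thesis .
  qed
  have half: "(\<Sum>k\<in>J. \<Sum>l | l \<in> J \<and> m l \<le> m k \<and> B k l. m k * m l / U k l) \<le> 2 * D * sum m J"
  proof -
    have "(\<Sum>l | l \<in> J \<and> m l \<le> m k \<and> B k l. m k * m l / U k l) \<le> m k * (2 * D)" for k
    proof -
      have "(\<Sum>l | l \<in> J \<and> m l \<le> m k \<and> B k l. m l / U k l) \<le>
          (\<Sum>l\<in>{l. l \<in> J \<and> k \<le> l \<and> m l \<le> m k \<and> B k l} \<union> {l. l \<in> J \<and> l \<le> k \<and> m l \<le> m k \<and> B k l}. m l / U k l)"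
        using J m U by (intro sum_mono2) (auto simp: less_imp_le)
      also have "\<dots> \<le> (\<Sum>l | l \<in> J \<and> k \<le> l \<and> m l \<le> m k \<and> B k l. m l / U k l) +
          (\<Sum>l | l \<in> J \<and> l \<le> k \<and> m l \<le> m k \<and> B k l. m l / U k l)"
        using J m U by (subst sum_Un) (auto intro!: sum_nonneg simp: less_imp_le)
      also have "\<dots> \<le> 2 * D" using left[of k] right[of k] by simp
      finally show ?thesis
        using m[of k] by (simp add: sum_distrib_left[symmetric] times_divide_eq_right[symmetric]
            del: times_divide_eq_right)
    qed
    then have "(\<Sum>k\<in>J. \<Sum>l | l \<in> J \<and> m l \<le> m k \<and> B k l. m k * m l / U k l) \<le> (\<Sum>k\<in>J. m k * (2 * D))"
      by (intro sum_mono)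
    also have "\<dots> = 2 * D * sum m J" by (simp add: sum_distrib_right[symmetric] mult.commute)
    finally show ?thesis .
  qed
  \<comment> \<open>A pair outside \<open>B\<close> is paid for by the first term; a pair in
    \<open>B\<close> is charged to its index with the larger \<open>m\<close>. Ties are charged
    twice, which only weakens the bound.\<close>
  have pt: "m k * m l / U k l \<le> m k * m l / \<epsilon> +
      (if m l \<le> m k \<and> B k l then m k * m l / U k l else 0) +
      (if m k \<le> m l \<and> B l k then m l * m k / U l k else 0)" for k l
  proof (cases "B k l")
    case True
    have "0 \<le> m k * m l / \<epsilon>" "0 \<le> m k * m l / U k l" using m U \<epsilon> by (simp_all add: less_imp_le)
    then show ?thesis using True Bsym Usym by (auto simp: mult.commute)
  next
    case False
    then have "\<epsilon> \<le> U k l" unfolding U_def B_def by (intro good) auto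
    then have "m k * m l / U k l \<le> m k * m l / \<epsilon>" using m \<epsilon> by (intro divide_left_mono) (auto simp: less_imp_le U)
    then show ?thesis using False Bsym by auto
  qed
  have "(\<Sum>k\<in>J. \<Sum>l\<in>J. m k * m l / U k l) \<le>
      (\<Sum>k\<in>J. \<Sum>l\<in>J. m k * m l / \<epsilon>) +
      (\<Sum>k\<in>J. \<Sum>l\<in>J. if m l \<le> m k \<and> B k l then m k * m l / U k l else 0) +
      (\<Sum>k\<in>J. \<Sum>l\<in>J. if m k \<le> m l \<and> B l k then m l * m k / U l k else 0)"
    unfolding sum.distrib[symmetric] by (intro sum_mono pt)
  also have "(\<Sum>k\<in>J. \<Sum>l\<in>J. if m k \<le> m l \<and> B l k then m l * m k / U l k else 0) =
      (\<Sum>k\<in>J. \<Sum>l\<in>J. if m l \<le> m k \<and> B k l then m k * m l / U k l else 0)"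
    by (rule sum.swap)
  also have "\<dots> = (\<Sum>k\<in>J. \<Sum>l | l \<in> J \<and> m l \<le> m k \<and> B k l. m k * m l / U k l)"
    using J by (simp add: sum.inter_filter)
  also have "(\<Sum>k\<in>J. \<Sum>l\<in>J. m k * m l / \<epsilon>) = sum m J ^ 2 / \<epsilon>"
    by (simp add: power2_eq_square sum_product sum_divide_distrib)
  finally show ?thesis using half by (simp add: U_def)
qed

section \<open>Translations of Lebesgue measure\<close>

lemma nn_integral_lborel_translate:
  fixes f :: "'a::euclidean_space \<Rightarrow> ennreal"
  assumes [measurable]: "f \<in> borel_measurable borel"
  shows "(\<integral>\<^sup>+x. f (a + x) \<partial>lborel) = (\<integral>\<^sup>+x. f x \<partial>lborel)"
proof -
  have "(\<integral>\<^sup>+x. f x \<partial>lborel) = (\<integral>\<^sup>+x. f x \<partial>distr lborel borel ((+) a))"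
    by (simp add: lborel_distr_plus)
  also have "\<dots> = (\<integral>\<^sup>+x. f (a + x) \<partial>lborel)"
    by (subst nn_integral_distr) auto
  finally show ?thesis by simp
qed

lemma emeasure_lborel_translate:
  fixes S :: "'a::euclidean_space set"
  assumes [measurable]: "S \<in> sets borel"
  shows "emeasure lborel {x. a + x \<in> S} = emeasure lborel S"
proof -
  have "emeasure lborel S = (\<integral>\<^sup>+x. indicator S (a + x) \<partial>lborel)"
    by (subst nn_integral_lborel_translate) auto
  also have "\<dots> = (\<integral>\<^sup>+x. indicator {x. a + x \<in> S} x \<partial>lborel)"
    by (intro nn_integral_cong) (auto simp: indicator_def)
  also have "\<dots> = emeasure lborel {x. a + x \<in> S}"
    by (rule nn_integral_indicator) auto
  finally show ?thesis by simp
qed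

text \<open>Approximate \<open>t\<close> by elements \<open>g n\<close> of \<open>G\<close>. Since
  \<open>U\<close> is open, a point moved into \<open>U\<close> by \<open>t\<close> is eventually
  moved into \<open>U\<close> by \<open>g n\<close>, so Fatou's lemma applies; by invariance of
  \<open>\<Omega>\<close> the sets for \<open>g n\<close> are translates of
  \<open>\<Omega> \<inter> U\<close>.\<close>

lemma emeasure_Int_open_translate_le:
  fixes \<Omega> U :: "'a::euclidean_space set"
  assumes \<Omega>[measurable]: "\<Omega> \<in> sets borel" and dense: "closure G = UNIV" and U: "open U"
    and inv: "\<And>g x. g \<in> G \<Longrightarrow> g + x \<in> \<Omega> \<longleftrightarrow> x \<in> \<Omega>"
  shows "emeasure lborel (\<Omega> \<inter> {x. t + x \<in> U}) \<le> emeasure lborel (\<Omega> \<inter> U)"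
proof -
  obtain g where g: "\<And>n. g n \<in> G" "g \<longlonglongrightarrow> t"
    using dense closure_sequential[of t G] by auto
  have [measurable]: "U \<in> sets borel" using U by simp
  have "emeasure lborel (\<Omega> \<inter> {x. t + x \<in> U}) = (\<integral>\<^sup>+x. indicator (\<Omega> \<inter> {x. t + x \<in> U}) x \<partial>lborel)"
    by (rule nn_integral_indicator[symmetric]) measurable
  also have "\<dots> \<le> (\<integral>\<^sup>+x. liminf (\<lambda>n. indicator (\<Omega> \<inter> {x. g n + x \<in> U}) x) \<partial>lborel)"
  proof (rule nn_integral_mono)
    fix x
    show "indicator (\<Omega> \<inter> {x. t + x \<in> U}) x \<le>
        liminf (\<lambda>n. indicator (\<Omega> \<inter> {x. g n + x \<in> U}) x :: ennreal)"
    proof (cases "x \<in> \<Omega> \<inter> {x. t + x \<in> U}")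
      case True
      have "(\<lambda>n. g n + x) \<longlonglongrightarrow> t + x" using g by (intro tendsto_intros)
      then have "\<forall>\<^sub>F n in sequentially. g n + x \<in> U"
        using U True by (auto elim!: topological_tendstoD)
      then have "\<forall>\<^sub>F n in sequentially. 1 \<le> (indicator (\<Omega> \<inter> {x. g n + x \<in> U}) x :: ennreal)"
        by eventually_elim (use True in auto)
      then have "1 \<le> liminf (\<lambda>n. indicator (\<Omega> \<inter> {x. g n + x \<in> U}) x :: ennreal)"
        by (intro Liminf_bounded) auto
      then show ?thesis using True by simp
    qed (auto simp: indicator_def)
  qed
  also have "\<dots> \<le> liminf (\<lambda>n. \<integral>\<^sup>+x. indicator (\<Omega> \<inter> {x. g n + x \<in> U}) x \<partial>lborel)"
    by (rule nn_integral_liminf) measurable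
  also have "(\<lambda>n. \<integral>\<^sup>+x. indicator (\<Omega> \<inter> {x. g n + x \<in> U}) x \<partial>lborel) = (\<lambda>n. emeasure lborel (\<Omega> \<inter> U))"
  proof
    fix n
    have eq: "\<Omega> \<inter> {x. g n + x \<in> U} = {x. g n + x \<in> \<Omega> \<inter> U}" using inv[OF g(1)] by auto
    have "(\<integral>\<^sup>+x. indicator (\<Omega> \<inter> {x. g n + x \<in> U}) x \<partial>lborel) = emeasure lborel (\<Omega> \<inter> {x. g n + x \<in> U})"
      by (rule nn_integral_indicator) measurable
    also have "\<dots> = emeasure lborel (\<Omega> \<inter> U)" unfolding eq
      by (rule emeasure_lborel_translate) auto
    finally show "(\<integral>\<^sup>+x. indicator (\<Omega> \<inter> {x. g n + x \<in> U}) x \<partial>lborel) = emeasure lborel (\<Omega> \<inter> U)" .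
  qed
  finally show ?thesis by (simp add: Liminf_const)
qed

text \<open>Covering the complement \<open>S\<close> of \<open>\<Omega>\<close> by an open set that is not much larger shows that \<open>\<Omega>\<close> meets
  every translate of \<open>S\<close> in a null set; integrating over all translates gives
  \<open>|\<Omega>| * |S| = 0\<close>.\<close>

lemma zero_one_law_dense_translations:
  fixes \<Omega> :: "'a::euclidean_space set"
  assumes \<Omega>[measurable]: "\<Omega> \<in> sets borel" and dense: "closure G = UNIV"
    and inv: "\<And>g x. g \<in> G \<Longrightarrow> g + x \<in> \<Omega> \<longleftrightarrow> x \<in> \<Omega>"
  shows "emeasure lborel \<Omega> = 0 \<or> emeasure lborel (- \<Omega>) = 0"
proof -
  have [measurable]: "- \<Omega> \<in> sets borel" using \<Omega> by auto
  have null: "emeasure lborel (\<Omega> \<inter> {x. t + x \<in> - \<Omega>}) = 0" for t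
  proof -
    have "emeasure lborel (\<Omega> \<inter> {x. t + x \<in> - \<Omega>}) \<le> 0 + ennreal e" if e: "e > 0" for e
    proof -
      have "- \<Omega> \<in> sets lebesgue" by (simp add: sets_completionI_sets)
      then obtain U where U: "open U" "- \<Omega> \<subseteq> U" "emeasure lebesgue (U - - \<Omega>) < ennreal e"
        using sets_lebesgue_outer_open[OF _ e] by metis
      have [measurable]: "U \<in> sets borel" using U by simp
      have eq: "U - - \<Omega> = \<Omega> \<inter> U" by auto
      have "emeasure lborel (\<Omega> \<inter> {x. t + x \<in> - \<Omega>}) \<le> emeasure lborel (\<Omega> \<inter> {x. t + x \<in> U})"
        by (rule emeasure_mono) (use U in auto)
      also have "\<dots> \<le> emeasure lborel (\<Omega> \<inter> U)"
        by (rule emeasure_Int_open_translate_le[OF \<Omega> dense U(1) inv])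
      also have "\<dots> < ennreal e" using U(3) unfolding eq by simp
      finally show ?thesis by simp
    qed
    then have "emeasure lborel (\<Omega> \<inter> {x. t + x \<in> - \<Omega>}) \<le> 0"
      by (metis ennreal_le_epsilon)
    then show ?thesis by simp
  qed
  have "0 = (\<integral>\<^sup>+t. emeasure lborel (\<Omega> \<inter> {x. t + x \<in> - \<Omega>}) \<partial>(lborel :: 'a measure))"
    by (simp only: null) simp
  also have "\<dots> = (\<integral>\<^sup>+t. (\<integral>\<^sup>+x. indicator \<Omega> x * indicator (- \<Omega>) (t + x) \<partial>lborel) \<partial>(lborel :: 'a measure))"
  proof (rule nn_integral_cong)
    fix t :: 'a
    have "emeasure lborel (\<Omega> \<inter> {x. t + x \<in> - \<Omega>}) = (\<integral>\<^sup>+x. indicator (\<Omega> \<inter> {x. t + x \<in> - \<Omega>}) x \<partial>lborel)"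
      by (rule nn_integral_indicator[symmetric]) measurable
    then show "emeasure lborel (\<Omega> \<inter> {x. t + x \<in> - \<Omega>}) = (\<integral>\<^sup>+x. indicator \<Omega> x * indicator (- \<Omega>) (t + x) \<partial>lborel)"
      by (simp add: indicator_def of_bool_def) (auto intro!: nn_integral_cong)
  qed
  also have "\<dots> = (\<integral>\<^sup>+x. (\<integral>\<^sup>+t. indicator \<Omega> x * indicator (- \<Omega>) (t + x) \<partial>lborel) \<partial>(lborel :: 'a measure))"
    by (rule lborel_pair.Fubini') measurable
  also have "\<dots> = (\<integral>\<^sup>+x. indicator \<Omega> x * emeasure lborel (- \<Omega>) \<partial>lborel)"
  proof (rule nn_integral_cong)
    fix x :: 'a
    have "(\<integral>\<^sup>+t. indicator (- \<Omega>) (t + x) \<partial>lborel) = emeasure lborel (- \<Omega>)"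
      using nn_integral_lborel_translate[of "indicator (- \<Omega>)" x] by (simp add: add.commute)
    then show "(\<integral>\<^sup>+t. indicator \<Omega> x * indicator (- \<Omega>) (t + x) \<partial>lborel) = indicator \<Omega> x * emeasure lborel (- \<Omega>)"
      by (subst nn_integral_cmult) auto
  qed
  also have "\<dots> = emeasure lborel \<Omega> * emeasure lborel (- \<Omega>)"
    by (subst nn_integral_multc) auto
  finally show ?thesis by simp
qed

section \<open>Counting lattice points in boxes\<close>

text \<open>Nonempty exactly when \<open>x\<close> lies, modulo the lattice, within \<open>r\<close>
  of some \<open>A *v q\<close> with \<open>q\<close> in the ball of radius \<open>T\<close>.
  Recording pairs instead of only \<open>q\<close> makes differences of hits lattice vectors in a
  box around 0, the objects that \<open>N\<close> counts.\<close>

definition hits :: "real ^ 'n ^ 'm \<Rightarrow> real \<Rightarrow> real \<Rightarrow> real ^ 'm \<Rightarrow> ((real ^ 'm) \<times> (real ^ 'n)) set" where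
  "hits A r T x = {(p, q). p \<in> int_lattice \<and> q \<in> int_lattice \<and>
     infnorm (A *v q - p - x) \<le> r \<and> infnorm q \<le> T}"

lemma N_eq_card_hits: "N A r T = card (hits A r T 0)"
  by (simp add: N_def hits_def)

lemma mem_hits_iff:
  "(p, q) \<in> hits A r T x \<longleftrightarrow> p \<in> int_lattice \<and> q \<in> int_lattice \<and>
     (\<forall>i. \<bar>(A *v q - p - x) $ i\<bar> \<le> r) \<and> (\<forall>j. \<bar>q $ j\<bar> \<le> T)"
  by (simp add: hits_def infnorm_le_iff)

lemma hits_mono:
  assumes "r \<le> r'" "T \<le> T'"
  shows "hits A r T x \<subseteq> hits A r' T' x"
  using assms by (auto simp: hits_def)

lemma finite_hits: "finite (hits A r T x)"
proof (rule finite_subset)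
  show "hits A r T x \<subseteq> hits A (r + infnorm x) T 0"
  proof (clarsimp simp: hits_def)
    fix p q assume "infnorm (A *v q - p - x) \<le> r"
    then show "infnorm (A *v q - p) \<le> r + infnorm x"
      using infnorm_triangle[of "A *v q - p - x" x] by simp
  qed
  show "finite (hits A (r + infnorm x) T 0)"
    unfolding hits_def using finite_N[of A "r + infnorm x" T] by simp
qed

lemma hits_diff:
  assumes "(p, q) \<in> hits A r T x" "(p', q') \<in> hits A r' T' x'"
  shows "(p - p', q - q') \<in> hits A (r + r') (T + T') (x - x')"
  unfolding mem_hits_iff
proof (intro conjI allI)
  show "p - p' \<in> int_lattice" "q - q' \<in> int_lattice"
    using assms by (auto simp: hits_def intro: int_lattice_diff)
next
  fix i
  have "(A *v (q - q') - (p - p') - (x - x')) $ i = (A *v q - p - x) $ i - (A *v q' - p' - x') $ i"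
    by (simp add: matrix_vector_mult_diff_distrib)
  moreover have "\<bar>(A *v q - p - x) $ i\<bar> \<le> r" "\<bar>(A *v q' - p' - x') $ i\<bar> \<le> r'"
    using assms by (auto simp: mem_hits_iff)
  ultimately show "\<bar>(A *v (q - q') - (p - p') - (x - x')) $ i\<bar> \<le> r + r'" by linarith
next
  fix j
  have "\<bar>q $ j\<bar> \<le> T" "\<bar>q' $ j\<bar> \<le> T'" using assms by (auto simp: mem_hits_iff)
  then show "\<bar>(q - q') $ j\<bar> \<le> T + T'" unfolding vector_minus_component by linarith
qed

lemma hits_minus:
  assumes "(p, q) \<in> hits A r T x"
  shows "(- p, - q) \<in> hits A r T (- x)"
proof -
  have "(A *v - q - - p - - x) $ i = - ((A *v q - p - x) $ i)" for i
    by (simp add: matrix_vector_mult_diff_distrib[of A 0 q, simplified])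
  then show ?thesis using assms by (simp add: mem_hits_iff del: vector_minus_component)
qed

lemma hits_add:
  assumes "(p, q) \<in> hits A r T x" "(p', q') \<in> hits A r' T' x'"
  shows "(p + p', q + q') \<in> hits A (r + r') (T + T') (x + x')"
  using hits_diff[OF assms(1) hits_minus[OF assms(2)]] by simp

lemma N_pos:
  assumes "0 \<le> r" "0 \<le> T"
  shows "N A r T > 0"
proof -
  have "(0, 0) \<in> hits A r T 0" using assms by (simp add: mem_hits_iff)
  then show ?thesis unfolding N_eq_card_hits using finite_hits card_gt_0_iff by blast
qed

lemma N_mono:
  assumes "r \<le> r'" "T \<le> T'"
  shows "N A r T \<le> N A r' T'"
  unfolding N_eq_card_hits by (intro card_mono finite_hits hits_mono assms)

lemma M_pos:
  assumes "0 < r" "0 < T"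
  shows "M A r T > 0"
  using N_pos[of r T A] assms by (simp add: M_def)

text \<open>A single hit can be shifted by every pair counted in \<open>N\<close>, so points that
  are hit at all are hit many times in a slightly larger box.\<close>

lemma N_le_card_hits:
  assumes "hits A r T x \<noteq> {}"
  shows "N A r' T' \<le> card (hits A (r + r') (T + T') x)"
proof -
  obtain p q where pq: "(p, q) \<in> hits A r T x" using assms by auto
  have "(\<lambda>z. (p, q) + z) ` hits A r' T' 0 \<subseteq> hits A (r + r') (T + T') x"
    using hits_add[OF pq, of _ _ r' T' 0] by auto
  then show ?thesis
    unfolding N_eq_card_hits by (intro card_inj_on_le[of "\<lambda>z. (p, q) + z"] finite_hits) (auto simp: inj_on_def)
qed

lemma card_le_card_times_fibres:
  assumes "finite P" "finite Z" "f ` P \<subseteq> Z" "\<And>z. z \<in> Z \<Longrightarrow> card {x \<in> P. f x = z} \<le> k"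
  shows "card P \<le> card Z * k"
proof -
  have "card P = (\<Sum>z\<in>Z. card {x \<in> P. f x = z})"
    using sum.group[OF assms(1-3), of "\<lambda>_. 1 :: nat"] by simp
  also have "\<dots> \<le> (\<Sum>z\<in>Z. k)" by (intro sum_mono assms(4))
  finally show ?thesis by simp
qed

text \<open>Subtracting a fixed element of a fibre embeds that fibre into the pairs counted by
  \<open>N\<close>.\<close>

lemma card_le_card_times_N:
  assumes "finite P" "finite Z" "f ` P \<subseteq> Z"
    and diff: "\<And>u v. u \<in> P \<Longrightarrow> v \<in> P \<Longrightarrow> f u = f v \<Longrightarrow> u - v \<in> hits A r T 0"
  shows "card P \<le> card Z * N A r T"
proof (rule card_le_card_times_fibres[OF assms(1-3)])
  fix z
  show "card {x \<in> P. f x = z} \<le> N A r T"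
  proof (cases "{x \<in> P. f x = z} = {}")
    case False
    then obtain u where u: "u \<in> P" "f u = z" by auto
    show ?thesis
      unfolding N_eq_card_hits
      by (rule card_inj_on_le[of "\<lambda>x. x - u"]) (use u finite_hits in \<open>auto intro!: inj_onI diff\<close>)
  qed (metis card.empty le0)
qed

text \<open>The lattice vector \<open>(A q - p, q)\<close>, rescaled so that \<open>hits A r T 0\<close> becomes the set of lattice
  vectors in the unit box.\<close>

definition normalize_pair :: "real ^ 'n ^ 'm \<Rightarrow> real \<Rightarrow> real \<Rightarrow> (real ^ 'm) \<times> (real ^ 'n) \<Rightarrow> real ^ ('m + 'n)" where
  "normalize_pair A r T z =
     (\<chi> i. case i of Inl a \<Rightarrow> (A *v snd z - fst z) $ a / r | Inr b \<Rightarrow> snd z $ b / T)"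

lemma normalize_pair_simps [simp]:
  "normalize_pair A r T z $ Inl a = (A *v snd z - fst z) $ a / r"
  "normalize_pair A r T z $ Inr b = snd z $ b / T"
  by (simp_all add: normalize_pair_def)

lemma linear_normalize_pair: "linear (normalize_pair (A :: real ^ 'n ^ 'm) r T)"
proof (rule linearI)
  fix u v :: "(real ^ 'm) \<times> (real ^ 'n)" and c :: real
  show "normalize_pair A r T (u + v) = normalize_pair A r T u + normalize_pair A r T v"
    by (auto simp: vec_eq_iff normalize_pair_def matrix_vector_right_distrib add_divide_distrib
        diff_divide_distrib split: sum.splits)
  show "normalize_pair A r T (c *\<^sub>R u) = c *\<^sub>R normalize_pair A r T u"
    by (auto simp: vec_eq_iff normalize_pair_def matrix_vector_mult_scaleR algebra_simps
        diff_divide_distrib split: sum.splits)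
qed

lemma mem_hits_0_iff_normalize:
  assumes "0 < r" "0 < T"
  shows "z \<in> hits A r T 0 \<longleftrightarrow> fst z \<in> int_lattice \<and> snd z \<in> int_lattice \<and>
    (\<forall>i. \<bar>normalize_pair A r T z $ i\<bar> \<le> 1)"
proof -
  have "(\<forall>i. \<bar>normalize_pair A r T z $ i\<bar> \<le> 1) \<longleftrightarrow>
      (\<forall>a. \<bar>(A *v snd z - fst z) $ a\<bar> \<le> r) \<and> (\<forall>b. \<bar>snd z $ b\<bar> \<le> T)"
    (is "?L \<longleftrightarrow> ?R")
  proof
    assume L: ?L
    have "\<bar>(A *v snd z - fst z) $ a\<bar> \<le> r" for a
      using spec[OF L, of "Inl a"] assms by (simp add: divide_le_eq)
    moreover have "\<bar>snd z $ b\<bar> \<le> T" for b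
      using spec[OF L, of "Inr b"] assms by (simp add: divide_le_eq)
    ultimately show ?R by blast
  next
    assume R: ?R
    show ?L
    proof
      fix i
      show "\<bar>normalize_pair A r T z $ i\<bar> \<le> 1"
        using R assms by (cases i) (auto simp: divide_le_eq)
    qed
  qed
  then show ?thesis by (cases z) (auto simp: mem_hits_iff)
qed

section \<open>Comparison of counts at different scales by the pigeonhole principle\<close>

lemma card_int_interval_le:
  fixes c :: real
  assumes "1 \<le> c"
  shows "real (card {- \<lceil>c\<rceil>..\<lfloor>c\<rfloor>}) \<le> 4 * c"
  using assms by (simp add: of_nat_nat) linarith

text \<open>Cut the normalized box into cells of width \<open>1 / c i\<close> in the coordinates
  \<open>i \<in> I\<close>; points in a common cell differ by a vector of the small box. The index
  set \<open>I\<close> may omit a coordinate that the remaining ones determine, which saves a factor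
  when the points lie in a hyperplane.\<close>

lemma card_hits_le_cells:
  fixes A :: "real ^ 'n ^ 'm" and c :: "'m + 'n \<Rightarrow> real"
  assumes rT: "0 < r" "0 < T" and c: "\<And>i. i \<in> I \<Longrightarrow> 1 \<le> c i"
    and diff: "\<And>u v. u \<in> hits A r T 0 \<Longrightarrow> v \<in> hits A r T 0 \<Longrightarrow>
      (\<And>i. i \<in> I \<Longrightarrow> \<bar>normalize_pair A r T u $ i - normalize_pair A r T v $ i\<bar> \<le> 1 / c i) \<Longrightarrow>
      u - v \<in> hits A r' T' 0"
  shows "real (N A r T) \<le> (\<Prod>i\<in>I. 4 * c i) * real (N A r' T')"
proof -
  define f where "f = (\<lambda>z. \<lambda>i\<in>I. \<lfloor>c i * normalize_pair A r T z $ i\<rfloor>)"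
  define Z where "Z = PiE I (\<lambda>i. {- \<lceil>c i\<rceil>..\<lfloor>c i\<rfloor>})"
  have "finite Z" unfolding Z_def by (intro finite_PiE) auto
  have "f ` hits A r T 0 \<subseteq> Z"
  proof (rule image_subsetI)
    fix z assume z: "z \<in> hits A r T 0"
    show "f z \<in> Z"
      unfolding f_def Z_def
    proof (rule restrict_PiE_iff[THEN iffD2], rule ballI)
      fix i assume i: "i \<in> I"
      have "\<bar>normalize_pair A r T z $ i\<bar> \<le> 1" using z mem_hits_0_iff_normalize[OF rT] by blast
      then have "\<bar>c i * normalize_pair A r T z $ i\<bar> \<le> c i"
        using c[OF i] by (simp add: abs_mult mult_left_le)
      then have "- c i \<le> c i * normalize_pair A r T z $ i" "c i * normalize_pair A r T z $ i \<le> c i"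
        by linarith+
      then show "\<lfloor>c i * normalize_pair A r T z $ i\<rfloor> \<in> {- \<lceil>c i\<rceil>..\<lfloor>c i\<rfloor>}"
        using floor_mono[of "- c i" "c i * normalize_pair A r T z $ i"]
        by (auto simp: floor_mono floor_minus)
    qed
  qed
  then have "card (hits A r T 0) \<le> card Z * N A r' T'"
  proof (rule card_le_card_times_N[OF finite_hits \<open>finite Z\<close>])
    fix u v assume uv: "u \<in> hits A r T 0" "v \<in> hits A r T 0" "f u = f v"
    show "u - v \<in> hits A r' T' 0"
    proof (rule diff[OF uv(1,2)])
      fix i assume i: "i \<in> I"
      have "\<lfloor>c i * normalize_pair A r T u $ i\<rfloor> = \<lfloor>c i * normalize_pair A r T v $ i\<rfloor>"
        using fun_cong[OF uv(3), of i] i by (simp add: f_def)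
      then have "\<bar>c i * normalize_pair A r T u $ i - c i * normalize_pair A r T v $ i\<bar> \<le> 1"
        by linarith
      then have "c i * \<bar>normalize_pair A r T u $ i - normalize_pair A r T v $ i\<bar> \<le> 1"
        using c[OF i] by (simp add: abs_mult flip: right_diff_distrib)
      then show "\<bar>normalize_pair A r T u $ i - normalize_pair A r T v $ i\<bar> \<le> 1 / c i"
        using c[OF i] by (simp add: field_simps)
    qed
  qed
  then have "real (N A r T) \<le> real (card Z) * real (N A r' T')"
    unfolding N_eq_card_hits by (metis of_nat_le_iff of_nat_mult)
  also have "real (card Z) = (\<Prod>i\<in>I. real (card {- \<lceil>c i\<rceil>..\<lfloor>c i\<rfloor>}))"
    unfolding Z_def by (subst card_PiE) auto
  also have "\<dots> \<le> (\<Prod>i\<in>I. 4 * c i)"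
    by (intro prod_mono conjI card_int_interval_le c) auto
  finally show ?thesis by (simp add: mult_right_mono)
qed

lemma hits_diff_0:
  assumes "u \<in> hits A r T 0" "v \<in> hits A r T 0"
  shows "fst (u - v) \<in> int_lattice" "snd (u - v) \<in> int_lattice"
  using assms by (auto simp: hits_def intro: int_lattice_diff)

lemma normalize_pair_diff:
  "normalize_pair A r T (u - v) = normalize_pair A r T u - normalize_pair A r T v"
  by (rule linear_diff[OF linear_normalize_pair])

text \<open>All coordinates are subdivided, the approximation block into width \<open>1 / K\<close>
  and the denominator block into width \<open>1 / L\<close>.\<close>

lemma N_le_scaled:
  fixes A :: "real ^ 'n ^ 'm"
  assumes rT: "0 < r" "0 < T" and K: "1 \<le> K" "1 \<le> L"
  shows "real (N A r T) \<le> (4 * K) ^ CARD('m) * (4 * L) ^ CARD('n) * real (N A (r / K) (T / L))"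
proof -
  define c :: "'m + 'n \<Rightarrow> real" where "c = case_sum (\<lambda>_. K) (\<lambda>_. L)"
  have "real (N A r T) \<le> (\<Prod>i\<in>UNIV. 4 * c i) * real (N A (r / K) (T / L))"
  proof (rule card_hits_le_cells[OF rT])
    show "1 \<le> c i" for i using K by (auto simp: c_def split: sum.splits)
    fix u v assume uv: "u \<in> hits A r T 0" "v \<in> hits A r T 0"
      "\<And>i. i \<in> UNIV \<Longrightarrow> \<bar>normalize_pair A r T u $ i - normalize_pair A r T v $ i\<bar> \<le> 1 / c i"
    have "\<bar>normalize_pair A (r / K) (T / L) (u - v) $ i\<bar> \<le> 1" for i
    proof -
      have "normalize_pair A (r / K) (T / L) (u - v) $ i = c i * normalize_pair A r T (u - v) $ i"
        by (cases i) (auto simp: c_def)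
      also have "\<bar>\<dots>\<bar> = c i * \<bar>normalize_pair A r T u $ i - normalize_pair A r T v $ i\<bar>"
        using K by (auto simp: abs_mult c_def normalize_pair_diff split: sum.splits)
      also have "\<dots> \<le> c i * (1 / c i)"
        by (intro mult_left_mono uv) (use K in \<open>auto simp: c_def split: sum.splits\<close>)
      also have "\<dots> = 1" using K by (auto simp: c_def split: sum.splits)
      finally show ?thesis .
    qed
    then show "u - v \<in> hits A (r / K) (T / L) 0"
      using K rT hits_diff_0[OF uv(1,2)] by (subst mem_hits_0_iff_normalize) auto
  qed
  also have "(\<Prod>i\<in>UNIV. 4 * c i) = (4 * K) ^ CARD('m) * (4 * L) ^ CARD('n)"
    by (simp flip: UNIV_Plus_UNIV add: prod.Plus c_def)
  finally show ?thesis .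
qed

text \<open>Quasi-monotonicity: enlarging the box multiplies
  \<open>r ^ CARD('m) * T ^ CARD('n)\<close> by exactly the powers of \<open>K\<close> and
  \<open>L\<close> by which \<open>N\<close> can grow, up to the factor 4 per coordinate.\<close>

lemma M_le_of_le:
  fixes A :: "real ^ 'n ^ 'm"
  assumes "0 < r'" "r' \<le> r" "0 < T'" "T' \<le> T"
  shows "M A r' T' \<le> 4 ^ (CARD('m) + CARD('n)) * M A r T"
proof -
  define K L where "K = r / r'" and "L = T / T'"
  have KL: "1 \<le> K" "1 \<le> L" "r / K = r'" "T / L = T'" "r = K * r'" "T = L * T'"
    using assms by (auto simp: K_def L_def)
  have N: "real (N A r' T') > 0" "real (N A r T) > 0" using assms by (auto intro!: N_pos)
  have "real (N A r T) \<le> (4 * K) ^ CARD('m) * (4 * L) ^ CARD('n) * real (N A r' T')"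
    using N_le_scaled[of r T K L A] KL assms by simp
  then have "(r' ^ CARD('m) * T' ^ CARD('n)) * real (N A r T) \<le>
     (r' ^ CARD('m) * T' ^ CARD('n)) * ((4 * K) ^ CARD('m) * (4 * L) ^ CARD('n) * real (N A r' T'))"
    using assms by (intro mult_left_mono) auto
  also have "\<dots> = 4 ^ (CARD('m) + CARD('n)) * (r ^ CARD('m) * T ^ CARD('n)) * real (N A r' T')"
    unfolding KL(5,6) by (simp add: power_mult_distrib power_add)
  finally show ?thesis
    unfolding M_def using N by (simp add: field_simps)
qed

text \<open>For positive \<open>r\<close> and \<open>T\<close> this says that the last successive
  minimum of the lattice of vectors \<open>(A *v q - p, q)\<close> with respect to the box of size
  \<open>(r, T)\<close> is at most 1.\<close>

definition spanning :: "real ^ 'n ^ 'm \<Rightarrow> real \<Rightarrow> real \<Rightarrow> bool" where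
  "spanning A r T \<longleftrightarrow> span (normalize_pair A r T ` hits A r T 0) = UNIV"

text \<open>Points confined to a hyperplane need one factor \<open>K\<close> fewer cells: the coordinate with the largest
  coefficient of the normal vector is determined by the others.\<close>

lemma N_le_scaled_of_not_spanning:
  fixes A :: "real ^ 'n ^ 'm"
  assumes rT: "0 < r" "0 < T" and K: "1 \<le> K" and span: "\<not> spanning A r T"
  defines "d \<equiv> CARD('m) + CARD('n)"
  shows "real (N A r T) \<le> (4 * real d * K) ^ (d - 1) * real (N A (r / K) (T / K))"
proof -
  define f where "f = normalize_pair A r T"
  have d: "card (UNIV :: ('m + 'n) set) = d" by (simp add: d_def)
  have d1: "1 \<le> d" by (simp add: d_def Suc_leI)
  obtain a where a: "a \<noteq> 0" "\<And>x. x \<in> span (f ` hits A r T 0) \<Longrightarrow> a \<bullet> x = 0"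
    using span span_not_UNIV_orthogonal unfolding spanning_def f_def by blast
  obtain k where k: "\<And>i. \<bar>a $ i\<bar> \<le> \<bar>a $ k\<bar>"
  proof -
    have "finite (range (\<lambda>i. \<bar>a $ i\<bar>))" by simp
    then have "Max (range (\<lambda>i. \<bar>a $ i\<bar>)) \<in> range (\<lambda>i. \<bar>a $ i\<bar>)" by (intro Max_in) auto
    then obtain k where "\<bar>a $ k\<bar> = Max (range (\<lambda>i. \<bar>a $ i\<bar>))" by (metis imageE)
    then show ?thesis using that[of k] by simp
  qed
  have ak: "\<bar>a $ k\<bar> > 0"
  proof (rule ccontr)
    assume "\<not> \<bar>a $ k\<bar> > 0"
    then have "a $ i = 0" for i using k[of i] by auto
    then show False using a(1) by (simp add: vec_eq_iff)
  qed
  \<comment> \<open>The cell width \<open>1 / (d * K)\<close> is chosen so that the errors of the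
    \<open>d - 1\<close> other coordinates, whose coefficients are at most
    \<open>\<bar>a $ k\<bar>\<close>, still add up to at most \<open>1 / K\<close> in coordinate
    \<open>k\<close>.\<close>
  have "real (N A r T) \<le> (\<Prod>i\<in>UNIV - {k}. 4 * (d * K)) * real (N A (r / K) (T / K))"
  proof (rule card_hits_le_cells[OF rT])
    show "1 \<le> d * K" using d1 K mult_mono[of 1 "real d" 1 K] by simp
    fix u v assume uv: "u \<in> hits A r T 0" "v \<in> hits A r T 0" and
      *: "\<And>i. i \<in> UNIV - {k} \<Longrightarrow> \<bar>normalize_pair A r T u $ i - normalize_pair A r T v $ i\<bar> \<le> 1 / (d * K)"
    define y where "y = f (u - v)"
    have y: "\<bar>y $ i\<bar> \<le> 1 / (d * K)" if "i \<noteq> k" for i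
      using *[of i] that by (simp add: y_def f_def normalize_pair_diff)
    have "y = f u - f v" by (simp add: y_def f_def normalize_pair_diff)
    then have "a \<bullet> y = 0"
      using a(2)[of y] uv(1,2) by (metis imageI span_base span_diff)
    then have "0 = (\<Sum>i\<in>UNIV. a $ i * y $ i)" by (simp add: inner_vec_def)
    also have "\<dots> = a $ k * y $ k + (\<Sum>i\<in>UNIV - {k}. a $ i * y $ i)"
      by (rule sum.remove) auto
    finally have "a $ k * y $ k = - (\<Sum>i\<in>UNIV - {k}. a $ i * y $ i)" by linarith
    then have "\<bar>a $ k\<bar> * \<bar>y $ k\<bar> = \<bar>\<Sum>i\<in>UNIV - {k}. a $ i * y $ i\<bar>" by (simp flip: abs_mult)
    also have "\<dots> \<le> (\<Sum>i\<in>UNIV - {k}. \<bar>a $ i * y $ i\<bar>)" by (rule sum_abs)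
    also have "\<dots> \<le> (\<Sum>i\<in>UNIV - {k}. \<bar>a $ k\<bar> * (1 / (d * K)))"
      unfolding abs_mult by (intro sum_mono mult_mono k y) auto
    also have "\<dots> = \<bar>a $ k\<bar> * ((real d - 1) / (d * K))"
      using d1 by (simp add: card_Diff_singleton d_def of_nat_diff)
    finally have "\<bar>y $ k\<bar> \<le> (real d - 1) / (d * K)" using ak by (simp only: mult_le_cancel_left_pos)
    also have "\<dots> \<le> d / (d * K)" using d1 K by (intro divide_right_mono) auto
    finally have yk: "\<bar>y $ k\<bar> \<le> 1 / K" using d1 by simp
    have "1 / (d * K) \<le> 1 / K" using d1 K by (simp add: field_simps)
    then have yi: "\<bar>y $ i\<bar> \<le> 1 / K" for i using y[of i] yk by (cases "i = k") auto
    have "\<bar>normalize_pair A (r / K) (T / K) (u - v) $ i\<bar> \<le> 1" for i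
    proof -
      have "normalize_pair A (r / K) (T / K) (u - v) $ i = K * y $ i"
        by (cases i) (auto simp: y_def f_def)
      then show ?thesis using yi[of i] K by (simp add: abs_mult field_simps)
    qed
    then show "u - v \<in> hits A (r / K) (T / K) 0"
      using K rT hits_diff_0[OF uv(1,2)] by (subst mem_hits_0_iff_normalize) auto
  qed
  moreover have "card (UNIV - {k} :: ('m + 'n) set) = d - 1" by (simp add: card_Diff_singleton d_def)
  ultimately show ?thesis by (simp only: prod_constant mult.assoc)
qed

text \<open>Shrinking divides the numerator of \<open>M\<close> by \<open>K ^ d\<close>, but the
  count by at most a constant times \<open>K ^ (d - 1)\<close>; one factor \<open>K\<close> is
  gained.\<close>

lemma M_scaled_le_of_not_spanning:
  fixes A :: "real ^ 'n ^ 'm"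
  assumes rT: "0 < r" "0 < T" and K: "1 \<le> K" and span: "\<not> spanning A r T"
  defines "d \<equiv> CARD('m) + CARD('n)"
  shows "M A (r / K) (T / K) \<le> (4 * real d) ^ d / K * M A r T"
proof -
  have d1: "1 \<le> d" by (simp add: d_def Suc_leI)
  have N: "real (N A (r / K) (T / K)) > 0" "real (N A r T) > 0" using assms by (auto intro!: N_pos)
  have "real (N A r T) \<le> (4 * real d * K) ^ (d - 1) * real (N A (r / K) (T / K))"
    using N_le_scaled_of_not_spanning[OF rT K span] by (simp add: d_def)
  also have "\<dots> \<le> ((4 * real d) ^ d * K ^ (d - 1)) * real (N A (r / K) (T / K))"
    using d1 K power_increasing[of "d - 1" d "4 * real d"]
    by (intro mult_right_mono) (auto simp: power_mult_distrib)
  finally have *: "real (N A r T) \<le> ((4 * real d) ^ d * K ^ (d - 1)) * real (N A (r / K) (T / K))" .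
  have "K ^ d = K * K ^ (d - 1)" using d1 by (simp add: power_eq_if)
  have "M A (r / K) (T / K) = r ^ CARD('m) * T ^ CARD('n) / K ^ d / real (N A (r / K) (T / K))"
    by (simp add: M_def d_def power_divide power_add)
  also have "\<dots> \<le> r ^ CARD('m) * T ^ CARD('n) / K ^ d * (((4 * real d) ^ d * K ^ (d - 1)) / real (N A r T))"
    using * N rT K unfolding divide_inverse mult.assoc
    by (intro mult_left_mono) (auto simp: field_simps)
  also have "\<dots> = (4 * real d) ^ d / K * M A r T"
    using K by (simp add: M_def \<open>K ^ d = K * K ^ (d - 1)\<close>)
  finally show ?thesis .
qed


text \<open>Expand the target in a basis of lattice vectors from the box and round the coefficients
  down. Each of the at most \<open>d\<close> basis vectors contributes an error of at most 1 to
  every normalized coordinate.\<close>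

lemma hits_nonempty_of_spanning:
  fixes A :: "real ^ 'n ^ 'm"
  assumes rT: "0 < r" "0 < T" and span: "spanning A r T"
  defines "d \<equiv> real (CARD('m) + CARD('n))"
  shows "hits A (d * r) (d * T) x \<noteq> {}"
proof -
  define f where "f = normalize_pair A r T"
  have lin: "linear f" by (simp add: f_def linear_normalize_pair)
  obtain B where B: "B \<subseteq> f ` hits A r T 0" "independent B" "f ` hits A r T 0 \<subseteq> span B"
    using maximal_independent_subset by blast
  have "span B = UNIV"
    using B(3) span span_mono[OF B(3)] unfolding spanning_def f_def by (simp add: span_span top.extremum_unique)
  have finB: "finite B" using B(2) independent_bound by blast
  have cardB: "real (card B) \<le> d"
    using independent_bound[OF B(2)] by (simp add: d_def)
  have "\<forall>b\<in>B. \<exists>z. z \<in> hits A r T 0 \<and> f z = b" using B(1) by blast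
  then obtain z where z: "\<And>b. b \<in> B \<Longrightarrow> z b \<in> hits A r T 0" "\<And>b. b \<in> B \<Longrightarrow> f (z b) = b"
    by metis
  \<comment> \<open>The normalized target: \<open>x\<close> in the approximation block, and 0 in the
    other block so that the resulting \<open>q\<close> stays small.\<close>
  define y :: "real ^ ('m + 'n)" where "y = (\<chi> i. case i of Inl a \<Rightarrow> x $ a / r | Inr b \<Rightarrow> 0)"
  have "y \<in> span B" using \<open>span B = UNIV\<close> by simp
  then obtain c where c: "y = (\<Sum>b\<in>B. c b *\<^sub>R b)" using span_finite[OF finB] by auto
  define w where "w = (\<Sum>b\<in>B. of_int \<lfloor>c b\<rfloor> *\<^sub>R z b)"
  have fw: "f w = (\<Sum>b\<in>B. of_int \<lfloor>c b\<rfloor> *\<^sub>R b)"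
    unfolding w_def linear_sum[OF lin] linear_scale[OF lin] using z by (intro sum.cong) auto
  have diff: "\<bar>(f w - y) $ i\<bar> \<le> d" for i
  proof -
    have "\<bar>(f w - y) $ i\<bar> = \<bar>\<Sum>b\<in>B. (of_int \<lfloor>c b\<rfloor> - c b) * b $ i\<bar>"
      by (simp add: fw c sum_component left_diff_distrib sum_subtractf)
    also have "\<dots> \<le> (\<Sum>b\<in>B. \<bar>of_int \<lfloor>c b\<rfloor> - c b\<bar> * \<bar>b $ i\<bar>)"
      unfolding abs_mult[symmetric] by (rule sum_abs)
    also have "\<dots> \<le> (\<Sum>b\<in>B. 1 * 1)"
    proof (intro sum_mono mult_mono)
      fix b assume "b \<in> B"
      then show "\<bar>b $ i\<bar> \<le> 1"
        using z[of b] mem_hits_0_iff_normalize[OF rT, of "z b" A] by (auto simp: f_def)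
      show "\<bar>of_int \<lfloor>c b\<rfloor> - c b\<bar> \<le> 1" by linarith
    qed auto
    finally show ?thesis using cardB by simp
  qed
  have zlat: "fst (z b) \<in> int_lattice" "snd (z b) \<in> int_lattice" if "b \<in> B" for b
    using z(1)[OF that] by (auto simp: hits_def)
  have lat: "fst w \<in> int_lattice" "snd w \<in> int_lattice"
    unfolding w_def int_lattice_def
    using zlat by (auto simp: fst_sum snd_sum sum_component int_lattice_def intro!: Ints_sum Ints_mult)
  have "(fst w, snd w) \<in> hits A (d * r) (d * T) x"
    unfolding mem_hits_iff
  proof (intro conjI allI lat)
    fix i
    have "(A *v snd w - fst w - x) $ i = r * (f w - y) $ Inl i"
      using rT by (simp add: f_def y_def right_diff_distrib diff_divide_distrib)
    then show "\<bar>(A *v snd w - fst w - x) $ i\<bar> \<le> d * r"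
      using diff[of "Inl i"] rT by (simp add: abs_mult mult.commute)
  next
    fix j
    have "snd w $ j = T * (f w - y) $ Inr j" using rT by (simp add: f_def y_def)
    then show "\<bar>snd w $ j\<bar> \<le> d * T"
      using diff[of "Inr j"] rT by (simp add: abs_mult mult.commute)
  qed
  then show ?thesis by auto
qed

section \<open>Integer points in a cube\<close>

definition lattice_ball :: "real \<Rightarrow> (real ^ 'n) set" where
  "lattice_ball T = {q \<in> int_lattice. infnorm q \<le> T}"

lemma finite_lattice_ball: "finite (lattice_ball T)"
  unfolding lattice_ball_def by (rule finite_int_lattice_ball)

lemma card_lattice_ball:
  assumes "0 \<le> T"
  shows "real (card (lattice_ball T :: (real ^ 'n) set)) = (2 * of_int \<lfloor>T\<rfloor> + 1) ^ CARD('n)"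
proof -
  define Z where "Z = (of_int ` {- \<lfloor>T\<rfloor>..\<lfloor>T\<rfloor>} :: real set)"
  have Z: "x \<in> Z \<longleftrightarrow> x \<in> \<int> \<and> \<bar>x\<bar> \<le> T" for x
    unfolding Z_def by (auto simp: Ints_def abs_le_iff le_floor_iff minus_le_iff image_iff)
  have "real (card Z) = 2 * of_int \<lfloor>T\<rfloor> + 1"
    unfolding Z_def using assms by (subst card_image) (auto simp: inj_on_def of_nat_nat)
  moreover have "(lattice_ball T :: (real ^ 'n) set) = vec_lambda ` (UNIV \<rightarrow>\<^sub>E Z)"
  proof (intro equalityI subsetI)
    fix q :: "real ^ 'n" assume "q \<in> lattice_ball T"
    then show "q \<in> vec_lambda ` (UNIV \<rightarrow>\<^sub>E Z)"
      by (intro image_eqI[of _ _ "vec_nth q"])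
        (auto simp: lattice_ball_def infnorm_le_iff int_lattice_def Z)
  qed (auto simp: lattice_ball_def infnorm_le_iff int_lattice_def Z PiE_iff)
  then have "card (lattice_ball T :: (real ^ 'n) set) = card ((UNIV :: 'n set) \<rightarrow>\<^sub>E Z)"
    by (simp add: card_image inj_on_def vec_lambda_inject)
  ultimately show ?thesis by (simp add: card_PiE)
qed

lemma card_lattice_ball_bounds:
  assumes "1 \<le> T"
  shows "T ^ CARD('n) \<le> real (card (lattice_ball T :: (real ^ 'n) set))"
    and "real (card (lattice_ball T :: (real ^ 'n) set)) \<le> (3 * T) ^ CARD('n)"
proof -
  have "T \<le> 2 * of_int \<lfloor>T\<rfloor> + 1" "2 * of_int \<lfloor>T\<rfloor> + 1 \<le> 3 * T" "0 \<le> 2 * real_of_int \<lfloor>T\<rfloor> + 1"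
    using assms by linarith+
  then show "T ^ CARD('n) \<le> real (card (lattice_ball T :: (real ^ 'n) set))"
      "real (card (lattice_ball T :: (real ^ 'n) set)) \<le> (3 * T) ^ CARD('n)"
    using assms by (simp_all only: card_lattice_ball power_mono)
qed

text \<open>Rounding \<open>A *v q\<close> gives every \<open>q\<close> in the ball at least one
  \<open>p\<close> within distance 1, so the count is at least \<open>T ^ CARD('n)\<close>.\<close>

lemma M_one_le:
  fixes A :: "real ^ 'n ^ 'm"
  assumes "1 \<le> T"
  shows "M A 1 T \<le> 1"
proof -
  define p where "p = (\<lambda>q. (\<chi> i. real_of_int (round ((A *v q) $ i))) :: real ^ 'm)"
  have "(\<lambda>q. (p q, q)) ` lattice_ball T \<subseteq> hits A 1 T 0"
  proof (rule image_subsetI)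
    fix q :: "real ^ 'n" assume q: "q \<in> lattice_ball T"
    have "\<bar>(A *v q) $ i - of_int (round ((A *v q) $ i))\<bar> \<le> 1" for i
      using of_int_round_abs_le[of "(A *v q) $ i"] by (simp add: abs_minus_commute)
    then show "(p q, q) \<in> hits A 1 T 0"
      using q unfolding mem_hits_iff
      by (auto simp: p_def lattice_ball_def int_lattice_def infnorm_le_iff)
  qed
  then have "card (lattice_ball T :: (real ^ 'n) set) \<le> N A 1 T"
    unfolding N_eq_card_hits by (intro card_inj_on_le[of "\<lambda>q. (p q, q)"] finite_hits) (auto simp: inj_on_def)
  then have "T ^ CARD('n) \<le> real (N A 1 T)"
    using card_lattice_ball_bounds(1)[OF assms, where 'n='n] by linarith
  then show ?thesis
    using N_pos[of 1 T A] assms by (simp add: M_def divide_le_eq)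
qed

section \<open>Moments of the counting function\<close>

text \<open>Half-open, unlike the closed cube behind the torus measure, so that its integer
  translates tile the space without overlap.\<close>

definition unit_cube :: "(real ^ 'm) set" where
  "unit_cube = {x. \<forall>i. 0 \<le> x $ i \<and> x $ i < 1}"

lemma unit_cube_borel [measurable]: "unit_cube \<in> sets borel"
  unfolding unit_cube_def by measurable

lemma countable_int_lattice: "countable (int_lattice :: (real ^ 'm) set)"
proof -
  have "countable (\<Union>n. {q \<in> int_lattice. infnorm (q :: real ^ 'm) \<le> real n})"
    by (rule countable_UN) (auto intro: countable_finite finite_int_lattice_ball)
  moreover have "int_lattice \<subseteq> (\<Union>n. {q \<in> int_lattice. infnorm (q :: real ^ 'm) \<le> real n})"
    using real_arch_simple by auto
  ultimately show ?thesis by (rule countable_subset[rotated])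
qed

lemma lattice_translate_unit_cube: "\<exists>p\<in>int_lattice. x - p \<in> unit_cube"
proof
  show "(\<chi> i. of_int \<lfloor>x $ i\<rfloor>) \<in> int_lattice" by (simp add: int_lattice_def)
  show "x - (\<chi> i. of_int \<lfloor>x $ i\<rfloor>) \<in> unit_cube"
    by (auto simp: unit_cube_def) linarith
qed

lemma lattice_translate_unit_cube_unique:
  assumes "p \<in> int_lattice" "q \<in> int_lattice" "x - p \<in> unit_cube" "x - q \<in> unit_cube"
  shows "p = q"
proof -
  have "p $ i = q $ i" for i
  proof -
    have "p $ i \<in> \<int>" "q $ i \<in> \<int>" using assms by (auto simp: int_lattice_def)
    then obtain a b where ab: "p $ i = of_int a" "q $ i = of_int b"
      by (auto elim!: Ints_cases)
    have "0 \<le> x $ i - of_int a" "x $ i - of_int a < 1" "0 \<le> x $ i - of_int b" "x $ i - of_int b < 1"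
      using assms(3,4) ab by (auto simp: unit_cube_def dest!: spec[of _ i])
    then have "a = b" by linarith
    then show ?thesis using ab by simp
  qed
  then show ?thesis by (simp add: vec_eq_iff)
qed

lemma nn_integral_lattice_tiling:
  fixes B :: "(real ^ 'm) set"
  assumes [measurable]: "B \<in> sets borel"
  shows "(\<integral>\<^sup>+p. emeasure lborel (B \<inter> {x. x - p \<in> unit_cube}) \<partial>count_space int_lattice) = emeasure lborel B"
proof -
  have "emeasure lborel (\<Union>p\<in>int_lattice. B \<inter> {x. x - p \<in> unit_cube}) =
      (\<integral>\<^sup>+p. emeasure lborel (B \<inter> {x. x - p \<in> unit_cube}) \<partial>count_space int_lattice)"
  proof (rule emeasure_UN_countable)
    show "B \<inter> {x. x - p \<in> unit_cube} \<in> sets lborel" for p by measurable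
    show "disjoint_family_on (\<lambda>p. B \<inter> {x. x - p \<in> unit_cube}) int_lattice"
      unfolding disjoint_family_on_def using lattice_translate_unit_cube_unique by blast
  qed (rule countable_int_lattice)
  moreover have "(\<Union>p\<in>int_lattice. B \<inter> {x. x - p \<in> unit_cube}) = B"
    using lattice_translate_unit_cube by auto
  ultimately show ?thesis by simp
qed

section \<open>First moments by unfolding lattice sums\<close>

definition lattice_count :: "real \<Rightarrow> real ^ 'm \<Rightarrow> nat" where
  "lattice_count r y = card {p \<in> int_lattice. infnorm (y - p) \<le> r}"

lemma finite_lattice_count: "finite {p \<in> int_lattice. infnorm (y - p) \<le> r}"
proof (rule finite_subset[OF _ finite_int_lattice_ball])
  show "{p \<in> int_lattice. infnorm (y - p) \<le> r} \<subseteq> {p \<in> int_lattice. infnorm p \<le> r + infnorm y}"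
  proof clarsimp
    fix p assume "infnorm (y - p) \<le> r"
    then show "infnorm p \<le> r + infnorm y"
      using infnorm_triangle[of "p - y" y] infnorm_sub[of p y] by simp
  qed
qed

lemma infnorm_measurable [measurable]: "infnorm \<in> borel_measurable borel"
  by (intro borel_measurable_continuous_onI continuous_on_infnorm continuous_on_id)

text \<open>As an integral against counting measure on the lattice, the count can be exchanged with
  a Lebesgue integral by Tonelli's theorem.\<close>

lemma lattice_count_eq_nn_integral:
  "of_nat (lattice_count r (c - x)) =
     (\<integral>\<^sup>+p. indicator {x. infnorm (c - x - p) \<le> r} x \<partial>count_space int_lattice)"
proof -
  have "(\<integral>\<^sup>+p. indicator {x. infnorm (c - x - p) \<le> r} x \<partial>count_space int_lattice) =
     (\<integral>\<^sup>+p. indicator {p \<in> int_lattice. infnorm (c - x - p) \<le> r} p \<partial>count_space int_lattice)"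
    by (intro nn_integral_cong) (auto simp: indicator_def)
  also have "\<dots> = of_nat (lattice_count r (c - x))"
    using finite_lattice_count[of "c - x" r]
    by (subst nn_integral_indicator) (auto simp: lattice_count_def)
  finally show ?thesis by simp
qed

lemma lattice_count_measurable [measurable]:
  fixes c :: "real ^ 'm"
  shows "(\<lambda>x. of_nat (lattice_count r (c - x)) :: ennreal) \<in> borel_measurable borel"
proof -
  interpret sigma_finite_measure "count_space (int_lattice :: (real ^ 'm) set)"
    by (rule sigma_finite_measure_count_space_countable[OF countable_int_lattice])
  have "(\<lambda>(x, p). indicator {x. infnorm (c - x - p) \<le> r} x :: ennreal)
      \<in> borel_measurable (borel \<Otimes>\<^sub>M count_space (int_lattice :: (real ^ 'm) set))"
    unfolding split_beta
    by (rule measurable_compose_countable'[where g = snd and I = int_lattice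
          and f = "\<lambda>p xp. indicator {x. infnorm (c - x - p) \<le> r} (fst xp)"])
      (auto intro: countable_int_lattice)
  then show ?thesis
    unfolding lattice_count_eq_nn_integral
    using borel_measurable_nn_integral[of "\<lambda>x p. indicator {x. infnorm (c - x - p) \<le> r} x" borel] by simp
qed

lemma emeasure_infnorm_ball:
  fixes c :: "real ^ 'm"
  assumes "0 \<le> r"
  shows "emeasure lborel {x. infnorm (c - x) \<le> r} = ennreal ((2 * r) ^ CARD('m))"
proof -
  have eq: "{x. infnorm (c - x) \<le> r} = cbox (c - (\<chi> i. r)) (c + (\<chi> i. r))"
    unfolding infnorm_le_iff mem_box_cart set_eq_iff
    by (auto simp: abs_le_iff) (smt (verit))+
  have ne: "cbox (c - (\<chi> i. r)) (c + (\<chi> i. r)) \<noteq> {}"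
    using assms by (auto simp: interval_ne_empty_cart)
  have "measure lborel (cbox (c - (\<chi> i. r)) (c + (\<chi> i. r))) = (2 * r) ^ CARD('m)"
    using ne by (simp add: content_cbox_cart)
  moreover have "emeasure lborel (cbox (c - (\<chi> i. r)) (c + (\<chi> i. r))) \<noteq> \<infinity>"
    using emeasure_lborel_cbox_finite by (simp add: less_top)
  ultimately show ?thesis unfolding eq by (simp add: emeasure_eq_ennreal_measure)
qed

text \<open>The integrand is the periodization of the indicator of a ball. Over a fundamental domain
  it integrates to the full volume of the ball, also when \<open>r\<close> is so large that the
  translates overlap.\<close>

lemma nn_integral_lattice_count:
  fixes c :: "real ^ 'm"
  assumes "0 \<le> r"
  shows "(\<integral>\<^sup>+x\<in>unit_cube. of_nat (lattice_count r (c - x)) \<partial>lborel) = ennreal ((2 * r) ^ CARD('m))"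
proof -
  define B where "B = {x. infnorm (c - x) \<le> r}"
  have [measurable]: "B \<in> sets borel" unfolding B_def by measurable
  have "(\<integral>\<^sup>+x\<in>unit_cube. of_nat (lattice_count r (c - x)) \<partial>lborel) =
      (\<integral>\<^sup>+x. (\<integral>\<^sup>+p. indicator {x. p + x \<in> B \<inter> {x. x - p \<in> unit_cube}} x \<partial>count_space int_lattice) \<partial>lborel)"
    unfolding lattice_count_eq_nn_integral
    by (intro nn_integral_cong) (auto simp: indicator_def B_def algebra_simps)
  also have "\<dots> = (\<integral>\<^sup>+p. (\<integral>\<^sup>+x. indicator {x. p + x \<in> B \<inter> {x. x - p \<in> unit_cube}} x \<partial>lborel) \<partial>count_space int_lattice)"
    by (rule nn_integral_count_space_nn_integral[OF countable_int_lattice]) simp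
  also have "\<dots> = (\<integral>\<^sup>+p. emeasure lborel (B \<inter> {x. x - p \<in> unit_cube}) \<partial>count_space int_lattice)"
  proof (intro nn_integral_cong)
    fix p :: "real ^ 'm"
    have "(\<integral>\<^sup>+x. indicator {x. p + x \<in> B \<inter> {x. x - p \<in> unit_cube}} x \<partial>lborel) =
        emeasure lborel {x. p + x \<in> B \<inter> {x. x - p \<in> unit_cube}}"
      by (rule nn_integral_indicator) measurable
    also have "\<dots> = emeasure lborel (B \<inter> {x. x - p \<in> unit_cube})"
      by (rule emeasure_lborel_translate) measurable
    finally show "(\<integral>\<^sup>+x. indicator {x. p + x \<in> B \<inter> {x. x - p \<in> unit_cube}} x \<partial>lborel) =
        emeasure lborel (B \<inter> {x. x - p \<in> unit_cube})" .
  qed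
  also have "\<dots> = emeasure lborel B" by (rule nn_integral_lattice_tiling) measurable
  finally show ?thesis using emeasure_infnorm_ball[OF assms] by (simp add: B_def)
qed

lemma card_hits_eq_sum:
  "card (hits A r T x) = (\<Sum>q\<in>lattice_ball T. lattice_count r (A *v q - x))"
proof -
  have "card (hits A r T x) =
      card (SIGMA q:lattice_ball T. {p \<in> int_lattice. infnorm (A *v q - x - p) \<le> r})"
    by (rule bij_betw_same_card[of prod.swap])
      (auto simp: bij_betw_def hits_def lattice_ball_def algebra_simps image_iff)
  then show ?thesis
    by (simp add: lattice_count_def finite_lattice_ball finite_lattice_count)
qed

lemma card_hits_measurable [measurable]:
  "(\<lambda>x. of_nat (card (hits A r T x)) :: ennreal) \<in> borel_measurable borel"
  unfolding card_hits_eq_sum of_nat_sum by measurable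

lemma nn_integral_card_hits:
  fixes A :: "real ^ 'n ^ 'm"
  assumes "0 \<le> r"
  shows "(\<integral>\<^sup>+x\<in>unit_cube. of_nat (card (hits A r T x)) \<partial>lborel) =
    ennreal (real (card (lattice_ball T :: (real ^ 'n) set)) * (2 * r) ^ CARD('m))"
proof -
  have "(\<integral>\<^sup>+x\<in>unit_cube. of_nat (card (hits A r T x)) \<partial>lborel) =
     (\<Sum>q\<in>lattice_ball T. (\<integral>\<^sup>+x\<in>unit_cube. of_nat (lattice_count r (A *v q - x)) \<partial>lborel))"
    unfolding card_hits_eq_sum of_nat_sum sum_distrib_right
    by (rule nn_integral_sum) measurable
  also have "\<dots> = of_nat (card (lattice_ball T :: (real ^ 'n) set)) * ennreal ((2 * r) ^ CARD('m))"
    using assms by (simp add: nn_integral_lattice_count)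
  finally show ?thesis using assms by (simp add: ennreal_mult ennreal_of_nat_eq_real_of_nat)
qed

text \<open>A pair of hits \<open>(p, q)\<close>, \<open>(p', q')\<close> is encoded by
  \<open>q\<close>, the difference of the two and \<open>p\<close>. The difference is a lattice
  vector independent of \<open>x\<close>, and lies in the box of size
  \<open>(2 * r, 2 * T')\<close>. Of the two closeness conditions only the sharper one, with
  \<open>r'\<close>, is kept for the count over \<open>p\<close>.\<close>

lemma card_hits_times_card_hits_le:
  fixes A :: "real ^ 'n ^ 'm"
  assumes "r' \<le> r" "T \<le> T'"
  shows "card (hits A r T x) * card (hits A r' T' x) \<le>
    (\<Sum>q\<in>lattice_ball T. \<Sum>z\<in>hits A (2 * r) (2 * T') 0. lattice_count r' (A *v (q + snd z) - fst z - x))"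
proof -
  define S where "S = (SIGMA q:lattice_ball T. SIGMA z:hits A (2 * r) (2 * T') 0.
      {p \<in> int_lattice. infnorm (A *v (q + snd z) - fst z - x - p) \<le> r'})"
  define f where "f = (\<lambda>(u, v). (snd u, v - u, fst u) :: (real ^ 'n) \<times> ((real ^ 'm) \<times> (real ^ 'n)) \<times> (real ^ 'm))"
  have finS: "finite S" unfolding S_def
    by (intro finite_SigmaI finite_lattice_ball finite_hits finite_lattice_count)
  have "f ` (hits A r T x \<times> hits A r' T' x) \<subseteq> S"
  proof
    fix w assume "w \<in> f ` (hits A r T x \<times> hits A r' T' x)"
    then obtain p q p' q' where w: "w = (q, (p' - p, q' - q), p)"
      and h: "(p, q) \<in> hits A r T x" "(p', q') \<in> hits A r' T' x" by (auto simp: f_def)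
    have "(p' - p, q' - q) \<in> hits A (r' + r) (T' + T) (x - x)" by (rule hits_diff[OF h(2,1)])
    then have "(p' - p, q' - q) \<in> hits A (2 * r) (2 * T') 0"
      using hits_mono[of "r' + r" "2 * r" "T' + T" "2 * T'" A 0] assms by auto
    moreover have eq: "A *v (q + (q' - q)) - (p' - p) - x - p = A *v q' - p' - x" by simp
    have "infnorm (A *v (q + (q' - q)) - (p' - p) - x - p) \<le> r'"
      unfolding eq using h by (simp add: hits_def)
    moreover have "q \<in> lattice_ball T" "p \<in> int_lattice"
      using h by (auto simp: hits_def lattice_ball_def)
    ultimately show "w \<in> S"
      unfolding w S_def mem_Sigma_iff mem_Collect_eq fst_conv snd_conv by blast
  qed
  moreover have "inj_on f (hits A r T x \<times> hits A r' T' x)"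
    by (auto simp: inj_on_def f_def)
  ultimately have "card (hits A r T x \<times> hits A r' T' x) \<le> card S"
    using finS by (intro card_inj_on_le)
  also have "card S = (\<Sum>q\<in>lattice_ball T. \<Sum>z\<in>hits A (2 * r) (2 * T') 0.
      lattice_count r' (A *v (q + snd z) - fst z - x))"
    unfolding S_def
    by (simp add: lattice_count_def finite_lattice_ball finite_lattice_count finite_hits)
  finally show ?thesis by (simp add: card_cartesian_product)
qed

lemma nn_integral_card_hits_times_card_hits_le:
  fixes A :: "real ^ 'n ^ 'm"
  assumes "0 \<le> r'" "r' \<le> r" "T \<le> T'"
  shows "(\<integral>\<^sup>+x\<in>unit_cube. of_nat (card (hits A r T x)) * of_nat (card (hits A r' T' x)) \<partial>lborel) \<le>
    ennreal (real (card (lattice_ball T :: (real ^ 'n) set)) * real (N A (2 * r) (2 * T')) * (2 * r') ^ CARD('m))"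
proof -
  have "(\<integral>\<^sup>+x\<in>unit_cube. of_nat (card (hits A r T x)) * of_nat (card (hits A r' T' x)) \<partial>lborel) \<le>
    (\<integral>\<^sup>+x. (\<Sum>q\<in>lattice_ball T. \<Sum>z\<in>hits A (2 * r) (2 * T') 0.
      of_nat (lattice_count r' (A *v (q + snd z) - fst z - x)) * indicator unit_cube x) \<partial>lborel)"
    unfolding sum_distrib_right[symmetric] of_nat_sum[symmetric] of_nat_mult[symmetric]
    by (intro nn_integral_mono mult_right_mono of_nat_mono card_hits_times_card_hits_le assms) auto
  also have "\<dots> = (\<Sum>q\<in>(lattice_ball T :: (real ^ 'n) set). \<Sum>z\<in>hits A (2 * r) (2 * T') 0. ennreal ((2 * r') ^ CARD('m)))"
    using assms by (simp add: nn_integral_sum nn_integral_lattice_count)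
  also have "\<dots> = ennreal (real (card (lattice_ball T :: (real ^ 'n) set)) * real (N A (2 * r) (2 * T')) * (2 * r') ^ CARD('m))"
    using assms by (simp add: N_eq_card_hits ennreal_mult ennreal_of_nat_eq_real_of_nat mult.assoc)
  finally show ?thesis .
qed

section \<open>Measure of the set of points that are hit\<close>

lemma nonempty_hits_borel [measurable]: "{x. hits A r T x \<noteq> {}} \<in> sets borel"
proof -
  have "{x. hits A r T x \<noteq> {}} = {x. (of_nat (card (hits A r T x)) :: ennreal) \<noteq> 0}"
    using finite_hits card_0_eq by (metis (no_types, lifting) of_nat_eq_0_iff)
  then show ?thesis by (simp only:) measurable
qed

text \<open>Markov's inequality: wherever there is a hit, the count in the enlarged box is at least
  \<open>N A r' T'\<close>, and the integral of that count is known.\<close>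

lemma emeasure_nonempty_hits_le:
  fixes A :: "real ^ 'n ^ 'm"
  assumes "0 \<le> r" "0 \<le> r'"
  shows "of_nat (N A r' T') * emeasure lborel ({x. hits A r T x \<noteq> {}} \<inter> unit_cube) \<le>
    ennreal (real (card (lattice_ball (T + T') :: (real ^ 'n) set)) * (2 * (r + r')) ^ CARD('m))"
proof -
  have "of_nat (N A r' T') * emeasure lborel ({x. hits A r T x \<noteq> {}} \<inter> unit_cube) =
     (\<integral>\<^sup>+x. of_nat (N A r' T') * indicator ({x. hits A r T x \<noteq> {}} \<inter> unit_cube) x \<partial>lborel)"
    by (rule nn_integral_cmult_indicator[symmetric]) measurable
  also have "\<dots> \<le> (\<integral>\<^sup>+x\<in>unit_cube. of_nat (card (hits A (r + r') (T + T') x)) \<partial>lborel)"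
    by (intro nn_integral_mono) (auto simp: indicator_def intro!: of_nat_mono N_le_card_hits)
  also have "\<dots> = ennreal (real (card (lattice_ball (T + T') :: (real ^ 'n) set)) * (2 * (r + r')) ^ CARD('m))"
    using assms by (intro nn_integral_card_hits) simp
  finally show ?thesis .
qed

lemma emeasure_unit_cube: "emeasure lborel (unit_cube :: (real ^ 'm) set) = 1"
proof -
  have "box 0 1 \<subseteq> (unit_cube :: (real ^ 'm) set)" "unit_cube \<subseteq> cbox (0 :: real ^ 'm) 1"
    by (auto simp: unit_cube_def mem_box_cart less_imp_le)
  then have "emeasure lborel (box 0 1 :: (real ^ 'm) set) \<le> emeasure lborel (unit_cube :: (real ^ 'm) set)"
      "emeasure lborel (unit_cube :: (real ^ 'm) set) \<le> emeasure lborel (cbox 0 1 :: (real ^ 'm) set)"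
    by (auto intro!: emeasure_mono)
  moreover have "(1 :: real ^ 'm) \<bullet> b = 1" if "b \<in> Basis" for b
    using that by (auto simp: Basis_vec_def inner_axis)
  ultimately show ?thesis
    by (simp add: emeasure_lborel_box_eq emeasure_lborel_cbox_eq)
qed

section \<open>Quasi-independence at geometric scales\<close>

text \<open>When the box enlarged by \<open>d\<close> hits every point, the set of hit points has
  full measure in the cube, and the preceding upper bound becomes an upper bound for
  \<open>N A r T\<close>.\<close>

lemma M_ge_of_spanning:
  fixes A :: "real ^ 'n ^ 'm"
  assumes r: "0 < r" and T: "1 \<le> T" and span: "spanning A r T"
  defines "d \<equiv> CARD('m) + CARD('n)"
  shows "1 / (3 * (real d + 1)) ^ d \<le> M A r T"
proof -
  have T0: "0 < T" using T by simp
  have "hits A (real d * r) (real d * T) x \<noteq> {}" for x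
    unfolding d_def by (rule hits_nonempty_of_spanning[OF r T0 span])
  then have "{x. hits A (d * r) (d * T) x \<noteq> {}} \<inter> unit_cube = unit_cube" by auto
  then have "of_nat (N A r T) \<le>
      ennreal (real (card (lattice_ball (d * T + T) :: (real ^ 'n) set)) * (2 * (d * r + r)) ^ CARD('m))"
    using emeasure_nonempty_hits_le[of "d * r" r A T "d * T"] r by (simp add: emeasure_unit_cube)
  then have "real (N A r T) \<le> real (card (lattice_ball (d * T + T) :: (real ^ 'n) set)) * (2 * (d * r + r)) ^ CARD('m)"
    using r by (simp add: ennreal_of_nat_eq_real_of_nat)
  also have "\<dots> \<le> (3 * (d * T + T)) ^ CARD('n) * (3 * (d * r + r)) ^ CARD('m)"
  proof -
    have "1 \<le> d * T + T" using T by (simp add: add_increasing)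
    then show ?thesis using T r by (intro mult_mono card_lattice_ball_bounds power_mono) auto
  qed
  also have "\<dots> = (3 * (real d + 1)) ^ d * (r ^ CARD('m) * T ^ CARD('n))"
  proof -
    have "3 * (d * T + T) = 3 * (real d + 1) * T" "3 * (d * r + r) = 3 * (real d + 1) * r"
      by (simp_all add: algebra_simps)
    then show ?thesis by (simp only: power_mult_distrib d_def power_add) (simp add: mult_ac)
  qed
  finally have "real (N A r T) \<le> (3 * (real d + 1)) ^ d * (r ^ CARD('m) * T ^ CARD('n))" .
  moreover have "0 < real (N A r T)" using N_pos[of r T A] r T by simp
  ultimately show ?thesis by (simp add: M_def field_simps)
qed

lemma M_le_of_not_spanning:
  fixes A :: "real ^ 'n ^ 'm"
  assumes "0 < r'" "r' \<le> r / K" "0 < T'" "T' \<le> T / K" "1 \<le> K" "\<not> spanning A r T"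
  defines "d \<equiv> CARD('m) + CARD('n)"
  shows "M A r' T' \<le> (16 * real d) ^ d / K * M A r T"
proof -
  have "0 < r / K" "0 < T / K" using assms(1-4) by linarith+
  then have rT: "0 < r" "0 < T" using assms(5) by (auto simp: zero_less_divide_iff)
  have "M A r' T' \<le> 4 ^ d * M A (r / K) (T / K)"
    unfolding d_def by (rule M_le_of_le[OF assms(1-4)])
  also have "M A (r / K) (T / K) \<le> (4 * real d) ^ d / K * M A r T"
    unfolding d_def by (rule M_scaled_le_of_not_spanning[OF rT assms(5,6)])
  finally have "M A r' T' \<le> 4 ^ d * ((4 * real d) ^ d / K * M A r T)" by simp
  also have "\<dots> = (16 * real d) ^ d / K * M A r T"
  proof -
    have "16 * real d = 4 * (4 * real d)" by simp
    then have "(16 * real d) ^ d = 4 ^ d * (4 * real d) ^ d"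
      by (simp only: power_mult_distrib[of 4 "4 * real d"])
    then show ?thesis by (simp only:) simp
  qed
  finally show ?thesis .
qed

text \<open>The scales are kept abstract because the divergence part works with halved values of
  \<open>\<psi>\<close> and of the dyadic radii, started late enough for regularity to hold.\<close>

locale geometric_scales =
  fixes A :: "real ^ 'n ^ 'm" and r T :: "nat \<Rightarrow> real" and \<rho> :: real
  assumes r_pos: "0 < r k" and r_Suc: "r (Suc k) \<le> \<rho> * r k" and \<rho>: "0 < \<rho>" "\<rho> < 1"
    and T_ge: "1 \<le> T k" and T_Suc: "T (Suc k) = 2 * T k"
begin

abbreviation "m k \<equiv> M A (r k) (T k)"
abbreviation "E k \<equiv> {x. hits A (r k) (T k) x \<noteq> {}}"

section \<open>Comparison of the boxes at different scales\<close>

lemma T_pos: "0 < T k" using T_ge[of k] by linarith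

lemma r_add_le: "r (k + j) \<le> \<rho> ^ j * r k"
proof (induction j)
  case (Suc j)
  have "r (k + Suc j) \<le> \<rho> * r (k + j)" using r_Suc[of "k + j"] by simp
  also have "\<dots> \<le> \<rho> * (\<rho> ^ j * r k)" using Suc \<rho> by (intro mult_left_mono) auto
  finally show ?case by simp
qed simp

lemma T_add: "T (k + j) = 2 ^ j * T k"
  by (induction j) (auto simp: T_Suc)

lemma r_antimono:
  assumes "k \<le> l"
  shows "r l \<le> r k"
proof -
  have "r l \<le> \<rho> ^ (l - k) * r k" using r_add_le[of k "l - k"] assms by simp
  also have "\<dots> \<le> 1 * r k" using \<rho> r_pos[of k] by (intro mult_right_mono power_le_one) auto
  finally show ?thesis by simp
qed

lemma T_mono: "k \<le> l \<Longrightarrow> T k \<le> T l"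
  using T_add[of k "l - k"] T_pos[of k] mult_right_mono[of 1 "2 ^ (l - k)" "T k"]
  by simp

text \<open>Compared with the box \<open>(r k, T l)\<close>, the box at \<open>s\<close> is smaller
  by \<open>\<rho> ^ (s - k)\<close> in one direction and by \<open>2 ^ (l - s)\<close> in the
  other. The guaranteed common shrinking is governed by the smaller exponent and the slower
  rate.\<close>

lemma m_le_of_not_spanning:
  assumes "k \<le> s" "s \<le> l" "\<not> spanning A (r k) (T l)"
  shows "m s \<le> (16 * real (CARD('m) + CARD('n))) ^ (CARD('m) + CARD('n)) *
    max \<rho> (1/2) ^ min (s - k) (l - s) * M A (r k) (T l)"
proof -
  define \<theta> where "\<theta> = max \<rho> (1/2)"
  define i where "i = min (s - k) (l - s)"
  have \<theta>: "0 < \<theta>" "\<theta> < 1" "\<rho> \<le> \<theta>" "1 / 2 \<le> \<theta>" using \<rho> by (auto simp: \<theta>_def)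
  have "r s \<le> \<rho> ^ (s - k) * r k" using r_add_le[of k "s - k"] assms by simp
  also have "\<dots> \<le> \<theta> ^ i * r k"
  proof (intro mult_right_mono)
    have "\<rho> ^ (s - k) \<le> \<theta> ^ (s - k)" using \<rho> \<theta> by (intro power_mono) auto
    also have "\<dots> \<le> \<theta> ^ i" using \<theta> by (intro power_decreasing) (auto simp: i_def)
    finally show "\<rho> ^ (s - k) \<le> \<theta> ^ i" .
  qed (use r_pos[of k] in auto)
  finally have rs: "r s \<le> r k / (1 / \<theta> ^ i)" by (simp add: mult.commute)
  have "T s = (1 / 2) ^ (l - s) * T l"
    using T_add[of s "l - s"] assms by (simp add: power_one_over)
  also have "\<dots> \<le> \<theta> ^ i * T l"
  proof (intro mult_right_mono)
    have "(1 / 2) ^ (l - s) \<le> \<theta> ^ (l - s)" using \<theta> by (intro power_mono) auto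
    also have "\<dots> \<le> \<theta> ^ i" using \<theta> by (intro power_decreasing) (auto simp: i_def)
    finally show "(1 / 2) ^ (l - s) \<le> \<theta> ^ i" .
  qed (use T_pos[of l] in auto)
  finally have Ts: "T s \<le> T l / (1 / \<theta> ^ i)" by (simp add: mult.commute)
  have "1 \<le> 1 / \<theta> ^ i" using \<theta> by (simp add: power_le_one)
  from M_le_of_not_spanning[OF r_pos rs T_pos Ts this assms(3)]
  show ?thesis by (simp add: \<theta>_def i_def)
qed

text \<open>Up to constants the second moment is
  \<open>T k ^ CARD('n) * r l ^ CARD('m) * N A (r k) (T l)\<close>: the smaller \<open>T\<close>,
  the smaller \<open>r\<close>, and the count in the box of the two larger sizes. Inserting the
  definition of \<open>M\<close> gives the stated form.\<close>

lemma correlation_le: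
  assumes "k \<le> l"
  shows "(\<integral>\<^sup>+x\<in>unit_cube. of_nat (card (hits A (r k) (T k) x)) * of_nat (card (hits A (r l) (T l) x)) \<partial>lborel)
    \<le> ennreal (24 ^ (CARD('m) + CARD('n)) * (real (N A (r k) (T k)) * real (N A (r l) (T l)) *
        (m k * m l / M A (r k) (T l))))"
proof -
  let ?d = "CARD('m) + CARD('n)"
  have pos: "0 < r k" "0 < r l" "0 < T k" "0 < T l" by (auto simp: r_pos T_pos)
  have N: "0 < real (N A (r k) (T k))" "0 < real (N A (r l) (T l))" "0 < real (N A (r k) (T l))"
    using pos by (auto intro!: N_pos)
  \<comment> \<open>Doubling the box costs \<open>4 * 2 = 8\<close> per coordinate. A further 3 per
    coordinate comes from counting integer points and from weakening \<open>2 * r l\<close> to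
    \<open>3 * r l\<close>, which gives 24.\<close>
  have "real (N A (2 * r k) (2 * T l)) \<le> 8 ^ ?d * real (N A (r k) (T l))"
    using N_le_scaled[of "2 * r k" "2 * T l" 2 2 A] pos by (simp add: power_add)
  then have "real (card (lattice_ball (T k) :: (real ^ 'n) set)) * real (N A (2 * r k) (2 * T l)) * (2 * r l) ^ CARD('m)
      \<le> (3 * T k) ^ CARD('n) * (8 ^ ?d * real (N A (r k) (T l))) * (2 * r l) ^ CARD('m)"
    using pos by (intro mult_right_mono mult_mono card_lattice_ball_bounds T_ge) auto
  also have "\<dots> \<le> (3 * T k) ^ CARD('n) * (8 ^ ?d * real (N A (r k) (T l))) * (3 * r l) ^ CARD('m)"
    using pos by (intro mult_left_mono power_mono) auto
  also have "\<dots> = 24 ^ ?d * (T k ^ CARD('n) * r l ^ CARD('m) * real (N A (r k) (T l)))"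
  proof -
    have "(24::real) ^ ?d = (3 * 8) ^ ?d" by simp
    then have "(24::real) ^ ?d = 3 ^ CARD('n) * 3 ^ CARD('m) * 8 ^ ?d"
      by (simp only: power_mult_distrib power_add mult_ac)
    then show ?thesis by (simp add: power_mult_distrib mult_ac)
  qed
  also have "T k ^ CARD('n) * r l ^ CARD('m) * real (N A (r k) (T l)) =
      real (N A (r k) (T k)) * real (N A (r l) (T l)) * (m k * m l / M A (r k) (T l))"
  proof -
    have alg: "N1 * N2 * (a * b / N1 * (c * e / N2) / (a * e / N3)) = b * c * N3"
      if "a \<noteq> 0" "e \<noteq> 0" "N1 \<noteq> 0" "N2 \<noteq> 0" for a b c e N1 N2 N3 :: real
      using that by simp
    show ?thesis
      unfolding M_def by (rule alg[symmetric]) (use N pos in auto)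
  qed
  finally have "real (card (lattice_ball (T k) :: (real ^ 'n) set)) * real (N A (2 * r k) (2 * T l)) * (2 * r l) ^ CARD('m)
     \<le> 24 ^ ?d * (real (N A (r k) (T k)) * real (N A (r l) (T l)) * (m k * m l / M A (r k) (T l)))" .
  then show ?thesis
    using nn_integral_card_hits_times_card_hits_le[of "r l" "r k" "T k" "T l" A] pos
      r_antimono[OF assms] T_mono[OF assms] by (meson ennreal_leI less_imp_le order_trans)
qed

text \<open>Division by the typical multiplicity of a hit makes each summand a substitute for the
  indicator of \<open>E k\<close> whose integral over the cube is of order
  \<open>m k\<close>.\<close>

definition hit_sum :: "nat set \<Rightarrow> real ^ 'm \<Rightarrow> ennreal" where
  "hit_sum J x = (\<Sum>k\<in>J. ennreal (1 / real (N A (r k) (T k))) * of_nat (card (hits A (r k) (T k) x)))"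

lemma hit_sum_measurable [measurable]: "hit_sum J \<in> borel_measurable borel"
  unfolding hit_sum_def by measurable

lemma N_gt_0: "0 < real (N A (r k) (T l))"
  using r_pos[of k] T_pos[of l] by (auto intro!: N_pos)

lemma nn_integral_hit_sum_ge: "ennreal (sum m J) \<le> (\<integral>\<^sup>+x\<in>unit_cube. hit_sum J x \<partial>lborel)"
proof -
  have "ennreal (sum m J) = (\<Sum>k\<in>J. ennreal (m k))"
    using r_pos T_pos by (intro sum_ennreal[symmetric]) (auto intro!: less_imp_le[OF M_pos])
  also have "\<dots> \<le> (\<Sum>k\<in>J. ennreal (1 / real (N A (r k) (T k))) *
      ennreal (real (card (lattice_ball (T k) :: (real ^ 'n) set)) * (2 * r k) ^ CARD('m)))"
  proof (rule sum_mono)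
    fix k
    have "r k ^ CARD('m) * T k ^ CARD('n) \<le> (2 * r k) ^ CARD('m) * real (card (lattice_ball (T k) :: (real ^ 'n) set))"
      using r_pos[of k] T_pos[of k] by (intro mult_mono power_mono card_lattice_ball_bounds T_ge) auto
    then have "m k \<le> 1 / real (N A (r k) (T k)) * (real (card (lattice_ball (T k) :: (real ^ 'n) set)) * (2 * r k) ^ CARD('m))"
      using N_gt_0[of k k] by (simp add: M_def divide_right_mono mult.commute)
    then show "ennreal (m k) \<le> ennreal (1 / real (N A (r k) (T k))) *
      ennreal (real (card (lattice_ball (T k) :: (real ^ 'n) set)) * (2 * r k) ^ CARD('m))"
      using r_pos[of k] by (subst ennreal_mult[symmetric]) (auto intro!: ennreal_leI)
  qed
  also have "\<dots> = (\<Sum>k\<in>J. \<integral>\<^sup>+x\<in>unit_cube. ennreal (1 / real (N A (r k) (T k))) * of_nat (card (hits A (r k) (T k) x)) \<partial>lborel)"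
    using r_pos by (intro sum.cong refl)
      (simp add: nn_integral_cmult nn_integral_card_hits less_imp_le mult.assoc)
  also have "\<dots> = (\<integral>\<^sup>+x\<in>unit_cube. hit_sum J x \<partial>lborel)"
    unfolding hit_sum_def sum_distrib_right by (rule nn_integral_sum[symmetric]) measurable
  finally show ?thesis .
qed

lemma nn_integral_hit_sum_squared_le:
  "(\<integral>\<^sup>+x\<in>unit_cube. (hit_sum J x) ^ 2 \<partial>lborel) \<le>
    ennreal (24 ^ (CARD('m) + CARD('n)) * (\<Sum>k\<in>J. \<Sum>l\<in>J. m k * m l / M A (r (min k l)) (T (max k l))))"
proof -
  let ?c = "24 ^ (CARD('m) + CARD('n)) :: real"
  let ?N = "\<lambda>k. real (N A (r k) (T k))"
  let ?h = "\<lambda>k x. of_nat (card (hits A (r k) (T k) x)) :: ennreal"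
  have corr: "(\<integral>\<^sup>+x\<in>unit_cube. ?h k x * ?h l x \<partial>lborel) \<le>
      ennreal (?c * (?N k * ?N l * (m k * m l / M A (r (min k l)) (T (max k l)))))" for k l
  proof (cases "k \<le> l")
    case True
    then show ?thesis using correlation_le[OF True] by simp
  next
    case False
    then show ?thesis using correlation_le[of l k] by (simp add: mult_ac)
  qed
  have inv: "ennreal (1 / ?N k * (1 / ?N l)) = ennreal (1 / ?N k) * ennreal (1 / ?N l)" for k l
    by (rule ennreal_mult) auto
  have M0: "0 \<le> M A (r i) (T j)" for i j using r_pos T_pos by (intro less_imp_le M_pos)
  have "(\<integral>\<^sup>+x\<in>unit_cube. (hit_sum J x) ^ 2 \<partial>lborel) =
    (\<integral>\<^sup>+x. (\<Sum>k\<in>J. \<Sum>l\<in>J. ennreal (1 / ?N k * (1 / ?N l)) * (?h k x * ?h l x * indicator unit_cube x)) \<partial>lborel)"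
    unfolding hit_sum_def power2_eq_square sum_product unfolding sum_distrib_right
    unfolding inv by (simp only: mult_ac)
  also have "\<dots> = (\<Sum>k\<in>J. \<Sum>l\<in>J. ennreal (1 / ?N k * (1 / ?N l)) * (\<integral>\<^sup>+x\<in>unit_cube. ?h k x * ?h l x \<partial>lborel))"
    by (simp add: nn_integral_sum nn_integral_cmult)
  also have "\<dots> \<le> (\<Sum>k\<in>J. \<Sum>l\<in>J. ennreal (1 / ?N k * (1 / ?N l)) *
      ennreal (?c * (?N k * ?N l * (m k * m l / M A (r (min k l)) (T (max k l))))))"
    by (intro sum_mono mult_left_mono corr) auto
  also have "\<dots> = (\<Sum>k\<in>J. \<Sum>l\<in>J. ennreal (?c * (m k * m l / M A (r (min k l)) (T (max k l)))))"
  proof (intro sum.cong refl)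
    fix k l
    have "ennreal (1 / ?N k * (1 / ?N l)) *
        ennreal (?c * (?N k * ?N l * (m k * m l / M A (r (min k l)) (T (max k l))))) =
      ennreal (1 / ?N k * (1 / ?N l) * (?c * (?N k * ?N l * (m k * m l / M A (r (min k l)) (T (max k l))))))"
      by (rule ennreal_mult[symmetric]) (use M0 in auto)
    also have "1 / ?N k * (1 / ?N l) * (?c * (?N k * ?N l * (m k * m l / M A (r (min k l)) (T (max k l))))) =
        ?c * (m k * m l / M A (r (min k l)) (T (max k l)))"
      using N_gt_0[of k k] N_gt_0[of l l] by simp
    finally show "ennreal (1 / ?N k * (1 / ?N l)) *
        ennreal (?c * (?N k * ?N l * (m k * m l / M A (r (min k l)) (T (max k l))))) =
       ennreal (?c * (m k * m l / M A (r (min k l)) (T (max k l))))" .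
  qed
  also have "\<dots> = ennreal (?c * (\<Sum>k\<in>J. \<Sum>l\<in>J. m k * m l / M A (r (min k l)) (T (max k l))))"
    using M0 by (simp add: sum_ennreal sum_nonneg sum_distrib_left)
  finally show ?thesis .
qed

text \<open>The second moment method: \<open>hit_sum J\<close> vanishes off the union, so
  Cauchy-Schwarz bounds the square of its integral by the second moment times the measure of the
  union. The correlation bound, with the non-spanning pairs as the bad ones, makes \<open>c\<close>
  independent of \<open>J\<close>.\<close>

lemma emeasure_Union_hits_ge:
  "\<exists>c>0. \<forall>J. finite J \<longrightarrow> 1 \<le> sum m J \<longrightarrow> ennreal c \<le> emeasure lborel ((\<Union>k\<in>J. E k) \<inter> unit_cube)"
proof -
  let ?d = "CARD('m) + CARD('n)"
  \<comment> \<open>The square root compensates for the squared rate required by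
    \<open>sum_correlations_le\<close>.\<close>
  define \<sigma> where "\<sigma> = sqrt (max \<rho> (1/2))"
  define C where "C = (16 * real ?d) ^ ?d"
  define \<epsilon> where "\<epsilon> = 1 / (3 * (real ?d + 1)) ^ ?d"
  define D where "D = 4 * C + 16 * C / (1 - \<sigma>) ^ 2"
  define F where "F = 24 ^ ?d * (1 / \<epsilon> + 4 * D)"
  have \<sigma>: "0 \<le> \<sigma>" "\<sigma> < 1" "\<sigma> ^ 2 = max \<rho> (1/2)" using \<rho> by (auto simp: \<sigma>_def)
  have C: "0 \<le> C" by (simp add: C_def)
  have \<epsilon>: "0 < \<epsilon>" by (simp add: \<epsilon>_def)
  have D: "0 \<le> D" using C by (simp add: D_def)
  have F: "0 < F" using \<epsilon> D by (auto simp: F_def intro!: mult_pos_pos add_pos_nonneg)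
  have "ennreal (1 / F) \<le> emeasure lborel ((\<Union>k\<in>J. E k) \<inter> unit_cube)"
    if J: "finite J" and S1: "1 \<le> sum m J" for J
  proof -
    let ?S = "sum m J"
    let ?E = "(\<Union>k\<in>J. E k) \<inter> unit_cube"
    have [measurable]: "?E \<in> sets borel" using J by measurable
    have "(\<Sum>k\<in>J. \<Sum>l\<in>J. m k * m l / M A (r (min k l)) (T (max k l))) \<le> ?S ^ 2 / \<epsilon> + 4 * D * ?S"
      unfolding D_def
    proof (rule sum_correlations_le[OF \<sigma>(1,2) C \<epsilon> _ _ _ _ J,
          where b = "\<lambda>k l. \<not> spanning A (r k) (T l)"])
      show "0 < m k" "0 < M A (r k) (T l)" for k l by (auto intro: M_pos r_pos T_pos)
      show "\<epsilon> \<le> M A (r k) (T l)" if "\<not> \<not> spanning A (r k) (T l)" for k l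
        unfolding \<epsilon>_def using M_ge_of_spanning[OF r_pos T_ge] that by blast
      show "m s \<le> C * (\<sigma>\<^sup>2) ^ min (s - k) (l - s) * M A (r k) (T l)"
        if "k \<le> s" "s \<le> l" "\<not> spanning A (r k) (T l)" for k s l
        unfolding C_def \<sigma>(3) using m_le_of_not_spanning[OF that] .
    qed
    also have "\<dots> \<le> (1 / \<epsilon> + 4 * D) * ?S ^ 2"
    proof -
      \<comment> \<open>The bad pairs contribute only linearly in the sum, which
        \<open>1 \<le> sum m J\<close> absorbs into the quadratic term.\<close>
      have "4 * D * ?S \<le> 4 * D * ?S ^ 2"
        using S1 D by (intro mult_left_mono) (auto simp: power2_eq_square)
      then show ?thesis by (simp add: algebra_simps)
    qed
    finally have "24 ^ ?d * (\<Sum>k\<in>J. \<Sum>l\<in>J. m k * m l / M A (r (min k l)) (T (max k l))) \<le> F * ?S ^ 2"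
      unfolding F_def mult.assoc by (intro mult_left_mono) auto
    then have Y2: "(\<integral>\<^sup>+x\<in>unit_cube. (hit_sum J x) ^ 2 \<partial>lborel) \<le> ennreal (F * ?S ^ 2)"
      using nn_integral_hit_sum_squared_le[of J] by (meson ennreal_leI order_trans)
    have Y0: "hit_sum J x * indicator unit_cube x = (hit_sum J x * indicator unit_cube x) * indicator ?E x" for x
    proof (cases "x \<in> ?E")
      case False
      then have "hit_sum J x = 0 \<or> x \<notin> unit_cube" by (auto simp: hit_sum_def)
      then show ?thesis by auto
    qed simp
    have "ennreal ?S ^ 2 \<le> (\<integral>\<^sup>+x. (hit_sum J x * indicator unit_cube x) * indicator ?E x \<partial>lborel) ^ 2"
      using nn_integral_hit_sum_ge[of J] by (intro power_mono) (simp_all flip: Y0)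
    also have "\<dots> \<le> (\<integral>\<^sup>+x. (hit_sum J x * indicator unit_cube x) ^ 2 \<partial>lborel) * (\<integral>\<^sup>+x. indicator ?E x ^ 2 \<partial>lborel)"
      by (rule Cauchy_Schwarz_nn_integral) measurable
    also have "(\<integral>\<^sup>+x. (hit_sum J x * indicator unit_cube x) ^ 2 \<partial>lborel) = (\<integral>\<^sup>+x\<in>unit_cube. (hit_sum J x) ^ 2 \<partial>lborel)"
      by (intro nn_integral_cong) (auto simp: indicator_def)
    also have "(\<integral>\<^sup>+x. indicator ?E x ^ 2 \<partial>lborel) = (\<integral>\<^sup>+x. indicator ?E x \<partial>(lborel :: (real ^ 'm) measure))"
      by (intro nn_integral_cong) (auto simp: indicator_def)
    also have "\<dots> = emeasure lborel ?E" by (rule nn_integral_indicator) measurable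
    finally have *: "ennreal ?S ^ 2 \<le> ennreal (F * ?S ^ 2) * emeasure lborel ?E"
      using Y2 by (meson mult_right_mono order_trans zero_le)
    have "emeasure lborel ?E \<le> emeasure lborel (unit_cube :: (real ^ 'm) set)"
      by (intro emeasure_mono) auto
    then have "emeasure lborel ?E < \<infinity>" by (simp add: emeasure_unit_cube le_less_trans)
    then obtain e where e: "0 \<le> e" "emeasure lborel ?E = ennreal e"
      by (cases "emeasure lborel ?E") auto
    have "ennreal (?S ^ 2) \<le> ennreal (F * ?S ^ 2 * e)"
      using * e S1 F by (simp add: ennreal_mult ennreal_power)
    then have "?S ^ 2 \<le> F * ?S ^ 2 * e" using e F by (subst (asm) ennreal_le_iff) auto
    then have "?S ^ 2 * 1 \<le> ?S ^ 2 * (F * e)" by (simp add: mult_ac)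
    then have "1 \<le> F * e" using S1 by (subst (asm) mult_le_cancel_left_pos) auto
    then have "1 / F \<le> e" using F by (simp add: field_simps)
    then show ?thesis unfolding e by (rule ennreal_leI)
  qed
  then show ?thesis using F by (intro exI[of _ "1 / F"]) auto
qed

text \<open>By divergence every tail contains a finite block with sum at least 1, so every tail
  union has measure at least \<open>c\<close> in the cube, and continuity from above passes this to
  the limit superior.\<close>

lemma emeasure_limsup_hits_pos:
  assumes "\<not> summable m"
  shows "emeasure lborel (\<Inter>n. \<Union>k\<in>{n..}. E k) \<noteq> 0"
proof -
  obtain c where c: "c > 0"
    "\<forall>J. finite J \<longrightarrow> 1 \<le> sum m J \<longrightarrow> ennreal c \<le> emeasure lborel ((\<Union>k\<in>J. E k) \<inter> unit_cube)"
    using emeasure_Union_hits_ge by (elim exE conjE) (rule that)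
  define B where "B = (\<lambda>n. (\<Union>k\<in>{n..}. E k) \<inter> unit_cube)"
  have m0: "0 \<le> m k" for k using M_pos[OF r_pos[of k] T_pos[of k], of A] by simp
  have [measurable]: "B n \<in> sets borel" for n unfolding B_def by measurable
  have B: "ennreal c \<le> emeasure lborel (B n)" for n
  proof -
    have "\<not> summable (\<lambda>k. m (k + n))" using assms summable_iff_shift[of m n] by simp
    have "\<exists>j. 1 < (\<Sum>k<j. m (k + n))"
    proof (rule ccontr)
      assume "\<nexists>j. 1 < (\<Sum>k<j. m (k + n))"
      then have "summable (\<lambda>k. m (k + n))"
        using m0 by (intro summableI_nonneg_bounded[where x = 1]) (auto simp: not_less)
      then show False using \<open>\<not> summable (\<lambda>k. m (k + n))\<close> by simp
    qed
    then obtain j where j: "1 < (\<Sum>k<j. m (k + n))" ..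
    then have "1 \<le> (\<Sum>k<j. m (k + n))" by simp
    also have "(\<Sum>k<j. m (k + n)) = sum m {n..<n + j}"
      by (rule sum.reindex_bij_witness[of _ "\<lambda>k. k - n" "\<lambda>k. k + n"]) auto
    finally have "ennreal c \<le> emeasure lborel ((\<Union>k\<in>{n..<n + j}. E k) \<inter> unit_cube)"
      by (intro c(2)[rule_format]) auto
    also have "\<dots> \<le> emeasure lborel (B n)" by (intro emeasure_mono) (auto simp: B_def)
    finally show ?thesis .
  qed
  have "emeasure lborel (B n) \<noteq> \<infinity>" for n
  proof -
    have "emeasure lborel (B n) \<le> emeasure lborel (unit_cube :: (real ^ 'm) set)"
      by (intro emeasure_mono) (auto simp: B_def)
    then show ?thesis by (auto simp: emeasure_unit_cube top_unique)
  qed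
  then have "(INF n. emeasure lborel (B n)) = emeasure lborel (\<Inter>n. B n)"
    by (intro INF_emeasure_decseq) (auto simp: decseq_def B_def)
  then have "ennreal c \<le> emeasure lborel (\<Inter>n. B n)" using B by (metis INF_greatest)
  also have "\<dots> \<le> emeasure lborel (\<Inter>n. \<Union>k\<in>{n..}. E k)"
    by (intro emeasure_mono) (auto simp: B_def)
  finally show ?thesis using c(1) by auto
qed

section \<open>Density of the orbit and the zero-one law\<close>

lemma r_tendsto_0: "r \<longlonglongrightarrow> 0"
proof (rule tendsto_sandwich[of "\<lambda>_. 0" _ _ "\<lambda>k. \<rho> ^ k * r 0"])
  show "\<forall>\<^sub>F k in sequentially. r k \<le> \<rho> ^ k * r 0" using r_add_le[of 0] by simp
  show "(\<lambda>k. \<rho> ^ k * r 0) \<longlonglongrightarrow> 0"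
    using \<rho> by (intro tendsto_mult_left_zero LIMSEQ_realpow_zero) auto
qed (auto intro!: always_eventually less_imp_le r_pos)

text \<open>If no box of width \<open>\<epsilon>\<close> were spanning, the gain from shrinking such
  boxes would give \<open>m k = O(r k)\<close>, and the geometric decay of \<open>r\<close> would
  make \<open>m\<close> summable.\<close>

lemma ex_spanning:
  assumes "\<not> summable m" and \<epsilon>: "0 < \<epsilon>" "\<epsilon> \<le> 1"
  shows "\<exists>t\<ge>1. spanning A \<epsilon> t"
proof (rule ccontr)
  assume "\<not> ?thesis"
  then have ns: "\<not> spanning A \<epsilon> t" if "1 \<le> t" for t using that by blast
  define d where "d = CARD('m) + CARD('n)"
  define c where "c = (16 * real d) ^ d * 4 ^ d / \<epsilon>"
  have le: "m k \<le> c * r k" if rk: "r k \<le> \<epsilon>" for k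
  proof -
    \<comment> \<open>With this \<open>K\<close> the box \<open>(r k, T k)\<close> is exactly the
      box \<open>(\<epsilon>, K * T k)\<close> shrunk by \<open>K\<close>. The latter is then
      compared with width 1, where \<open>M\<close> is at most 1.\<close>
    define K where "K = \<epsilon> / r k"
    have K: "1 \<le> K" "r k = \<epsilon> / K" "T k = (K * T k) / K"
      using rk r_pos[of k] \<epsilon> by (auto simp: K_def)
    have KT: "1 \<le> K * T k" using mult_mono[OF K(1) T_ge[of k]] K(1) by simp
    have "m k \<le> (16 * real d) ^ d / K * M A \<epsilon> (K * T k)"
      unfolding d_def
      by (rule M_le_of_not_spanning) (use K KT r_pos[of k] T_pos[of k] ns in auto)
    also have "M A \<epsilon> (K * T k) \<le> 4 ^ d * M A 1 (K * T k)"
      unfolding d_def by (rule M_le_of_le) (use \<epsilon> KT in auto)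
    also have "M A 1 (K * T k) \<le> 1" by (rule M_one_le[OF KT])
    finally have "m k \<le> (16 * real d) ^ d / K * (4 ^ d * 1)"
      using K(1) by (simp add: mult_left_mono divide_right_mono)
    also have "\<dots> = c * r k" using \<epsilon> by (simp add: c_def K_def)
    finally show ?thesis .
  qed
  have "\<forall>\<^sub>F k in sequentially. r k < \<epsilon>" by (rule order_tendstoD(2)[OF r_tendsto_0 \<epsilon>(1)])
  then have "\<forall>\<^sub>F k in sequentially. norm (m k) \<le> c * (\<rho> ^ k * r 0)"
  proof eventually_elim
    case (elim k)
    have "0 \<le> c" using \<epsilon> by (simp add: c_def)
    have "m k \<le> c * r k" using le elim by simp
    also have "\<dots> \<le> c * (\<rho> ^ k * r 0)" using r_add_le[of 0 k] \<open>0 \<le> c\<close> by (intro mult_left_mono) auto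
    finally show ?case using M_pos[OF r_pos[of k] T_pos[of k], of A] by simp
  qed
  moreover have "summable (\<lambda>k. c * (\<rho> ^ k * r 0))"
    using \<rho> by (intro summable_mult summable_mult2 summable_geometric) auto
  ultimately have "summable m" by (rule summable_comparison_test_ev)
  then show False using assms(1) by simp
qed

text \<open>A spanning box of width \<open>\<epsilon>\<close> forces some \<open>A *v q - p\<close>
  within \<open>d * \<epsilon>\<close> of any given point.\<close>

lemma closure_orbit:
  assumes "\<not> summable m"
  shows "closure {A *v q - p | p q. p \<in> int_lattice \<and> q \<in> int_lattice} = UNIV"
proof -
  define d where "d = real (CARD('m) + CARD('n))"
  define s where "s = sqrt (real DIM(real ^ 'm))"
  have d: "0 < d" unfolding d_def of_nat_0_less_iff by simp
  have s: "0 < s" by (simp add: s_def)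
  have "\<exists>y\<in>{A *v q - p | p q. p \<in> int_lattice \<and> q \<in> int_lattice}. dist y x < e" if e: "0 < e" for x e
  proof -
    \<comment> \<open>Makes \<open>s * d * \<epsilon>\<close> at most \<open>e / 2\<close>, where
      \<open>s\<close> converts the supremum norm to the Euclidean one; the cap 1 is needed for
      \<open>ex_spanning\<close>.\<close>
    define \<epsilon> where "\<epsilon> = min 1 (e / (2 * d * s))"
    have \<epsilon>: "0 < \<epsilon>" "\<epsilon> \<le> 1" using e d s by (auto simp: \<epsilon>_def)
    obtain t where t: "1 \<le> t" "spanning A \<epsilon> t" using ex_spanning[OF assms \<epsilon>] by blast
    then have "hits A (d * \<epsilon>) (d * t) x \<noteq> {}"
      unfolding d_def using \<epsilon> by (intro hits_nonempty_of_spanning) auto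
    then obtain p q where pq: "p \<in> int_lattice" "q \<in> int_lattice" "infnorm (A *v q - p - x) \<le> d * \<epsilon>"
      by (auto simp: hits_def)
    have "dist (A *v q - p) x \<le> s * infnorm (A *v q - p - x)"
      using norm_le_infnorm[of "A *v q - p - x"] by (simp add: dist_norm s_def)
    also have "\<dots> \<le> s * (d * (e / (2 * d * s)))"
      using pq(3) d s by (intro mult_left_mono order_trans[OF pq(3)]) (auto simp: \<epsilon>_def)
    also have "\<dots> < e" using d s e by simp
    finally show ?thesis using pq by blast
  qed
  then show ?thesis by (auto simp: closure_approachable)
qed

text \<open>The union of translates is invariant under the dense group of all
  \<open>A *v q - p\<close> and contains the limit superior, which has positive measure; the
  zero-one law leaves only full measure.\<close>

lemma emeasure_orbit_limsup_compl:
  assumes "\<not> summable m"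
  shows "emeasure lborel (- (\<Union>z\<in>int_lattice \<times> int_lattice.
    {x. A *v snd z - fst z + x \<in> (\<Inter>n. \<Union>k\<in>{n..}. E k)})) = 0"
proof -
  define L where "L = (\<Inter>n. \<Union>k\<in>{n..}. E k)"
  define g where "g = (\<lambda>z. A *v snd z - fst z)"
  define \<Omega> where "\<Omega> = (\<Union>z\<in>int_lattice \<times> int_lattice. {x. g z + x \<in> L})"
  have [measurable]: "L \<in> sets borel" unfolding L_def by measurable
  have meas: "\<Omega> \<in> sets borel"
    unfolding \<Omega>_def
    by (intro sets.countable_UN' countable_SIGMA countable_int_lattice) auto
  have shift: "y + x \<in> \<Omega>" if z: "z \<in> int_lattice \<times> int_lattice" and y: "y = g z" and x: "x \<in> \<Omega>" for z x y
  proof -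
    obtain w where w: "w \<in> int_lattice \<times> int_lattice" "g w + x \<in> L"
      using x by (auto simp: \<Omega>_def)
    have wz: "w - z \<in> int_lattice \<times> int_lattice" using z w by (auto intro: int_lattice_diff)
    have eq: "g (w - z) + (y + x) = g w + x"
      by (simp add: g_def y matrix_vector_mult_diff_distrib)
    have "g (w - z) + (y + x) \<in> L" unfolding eq by (rule w(2))
    then show ?thesis unfolding \<Omega>_def by (intro UN_I[OF wz] CollectI)
  qed
  have "emeasure lborel \<Omega> = 0 \<or> emeasure lborel (- \<Omega>) = 0"
  proof (rule zero_one_law_dense_translations[OF meas closure_orbit[OF assms]])
    fix y x assume "y \<in> {A *v q - p | p q. p \<in> int_lattice \<and> q \<in> int_lattice}"
    then obtain p q where pq: "y = A *v q - p" "p \<in> int_lattice" "q \<in> int_lattice" by blast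
    have neg: "- y = g (- p, - q)"
      using matrix_vector_mult_diff_distrib[of A 0 q] by (simp add: g_def pq)
    show "y + x \<in> \<Omega> \<longleftrightarrow> x \<in> \<Omega>"
      using shift[of "(p, q)" y x] shift[of "(- p, - q)" "- y" "y + x"] neg pq
      by (auto simp: g_def)
  qed
  moreover have "emeasure lborel \<Omega> \<noteq> 0"
  proof
    assume "emeasure lborel \<Omega> = 0"
    moreover have "L \<subseteq> \<Omega>"
    proof
      fix x assume "x \<in> L"
      then have "g (0, 0) + x \<in> L" by (simp add: g_def)
      then show "x \<in> \<Omega>" unfolding \<Omega>_def by (intro UN_I[of "(0, 0)"]) auto
    qed
    ultimately have "emeasure lborel L = 0"
      using emeasure_mono[of L \<Omega> lborel] meas by simp
    then show False using emeasure_limsup_hits_pos[OF assms] by (simp add: L_def)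
  qed
  ultimately show ?thesis by (simp add: \<Omega>_def g_def L_def)
qed

end

section \<open>The approximable points\<close>

lemma lattice_norm_le: "p \<in> int_lattice \<Longrightarrow> lattice_norm x \<le> infnorm (x - p)"
  unfolding lattice_norm_def by (intro cINF_lower bdd_belowI2[of _ 0]) (auto simp: infnorm_pos_le)

lemma lattice_norm_less_iff: "lattice_norm x < c \<longleftrightarrow> (\<exists>p\<in>int_lattice. infnorm (x - p) < c)"
  using lattice_norm_attained[of x] lattice_norm_le[of _ x] by (metis le_less_trans)

definition approximable :: "real ^ 'n ^ 'm \<Rightarrow> (real \<Rightarrow> real) \<Rightarrow> (real ^ 'm) set" where
  "approximable A \<psi> = {b. infinite {q \<in> int_lattice - {0}. lattice_norm (A *v q - b) < \<psi> (infnorm q)}}"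

lemma vimage_W: "torus_class -` W A \<psi> = approximable A \<psi>"
  by (auto simp: torus_class_in_W_iff approximable_def)

text \<open>Balls contain finitely many integer points, so infinitely many solutions means
  arbitrarily large ones. The strict bound by \<open>real n\<close> also excludes
  \<open>q = 0\<close>.\<close>

lemma mem_approximable_iff:
  "b \<in> approximable A \<psi> \<longleftrightarrow>
    (\<forall>n::nat. \<exists>q\<in>int_lattice. real n < infnorm q \<and> lattice_norm (A *v q - b) < \<psi> (infnorm q))"
  (is "_ \<longleftrightarrow> (\<forall>n. ?P n)")
proof -
  let ?S = "{q \<in> int_lattice - {0}. lattice_norm (A *v q - b) < \<psi> (infnorm q)}"
  have "infinite ?S \<longleftrightarrow> (\<forall>n. ?P n)"
  proof
    assume inf: "infinite ?S"
    show "\<forall>n. ?P n"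
    proof
      fix n
      have "\<not> ?S \<subseteq> {q \<in> int_lattice. infnorm q \<le> real n}"
        using inf finite_int_lattice_ball finite_subset by blast
      then show "?P n" by (auto simp: not_le)
    qed
  next
    assume P: "\<forall>n. ?P n"
    show "infinite ?S"
    proof
      assume "finite ?S"
      then have "bdd_above (infnorm ` ?S)" by simp
      then obtain u where u: "\<And>q. q \<in> ?S \<Longrightarrow> infnorm q \<le> u" by (auto simp: bdd_above_def)
      obtain n where "u < real n" using reals_Archimedean2 by blast
      moreover obtain q where q: "q \<in> int_lattice" "real n < infnorm q" "lattice_norm (A *v q - b) < \<psi> (infnorm q)"
        using P by blast
      moreover have "q \<noteq> 0" using q(2) by (auto simp: infnorm_0)
      ultimately show False using u[of q] by auto
    qed
  qed
  then show ?thesis by (simp add: approximable_def)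
qed

lemma approximable_borel: "approximable (A :: real ^ 'n ^ 'm) \<psi> \<in> sets borel"
proof -
  have "approximable A \<psi> = (\<Inter>n::nat. \<Union>q\<in>{q \<in> int_lattice. real n < infnorm q}.
      \<Union>p\<in>int_lattice. {b. infnorm (A *v q - b - p) < \<psi> (infnorm q)})"
    by (simp add: set_eq_iff mem_approximable_iff lattice_norm_less_iff) blast
  also have "\<dots> \<in> sets borel"
  proof -
    have "countable {q \<in> int_lattice. real n < infnorm (q :: real ^ 'n)}" for n
      by (rule countable_subset[OF _ countable_int_lattice]) auto
    then show ?thesis
      by (intro sets.countable_INT sets.countable_UN' countable_int_lattice image_subsetI) auto
  qed
  finally show ?thesis .
qed

lemma emeasure_cbox_0_1: "emeasure lborel (cbox 0 1 :: (real ^ 'm) set) = 1"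
proof -
  have "(1 :: real ^ 'm) \<bullet> b = 1" if "b \<in> Basis" for b
    using that by (auto simp: Basis_vec_def inner_axis)
  then show ?thesis by (simp add: emeasure_lborel_cbox_eq)
qed

lemma emeasure_W:
  fixes A :: "real ^ 'n ^ 'm"
  shows "W A \<psi> \<in> sets torus_measure"
    and "emeasure torus_measure (W A \<psi>) = emeasure lborel (approximable A \<psi> \<inter> cbox 0 1)"
proof -
  have "W A \<psi> \<subseteq> torus" by (auto simp: W_def)
  then show sets: "W A \<psi> \<in> sets torus_measure"
    using approximable_borel[of A \<psi>] by (auto simp: sets_torus_measure vimage_W sets_completionI_sets)
  show "emeasure torus_measure (W A \<psi>) = emeasure lborel (approximable A \<psi> \<inter> cbox 0 1)"
    unfolding emeasure_torus_measure[OF sets] vimage_W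
    by (simp add: approximable_borel sets.Int)
qed

section \<open>The convergence case\<close>

lemma ex_dyadic_interval:
  fixes t :: real
  assumes "1 \<le> t"
  shows "\<exists>k. 2 ^ k \<le> t \<and> t < 2 ^ Suc k"
proof -
  obtain j where j: "t < 2 ^ j" using real_arch_pow[of 2 t] by auto
  define l where "l = (LEAST j. t < 2 ^ j)"
  have l: "t < 2 ^ l" unfolding l_def by (rule LeastI[of _ j]) (rule j)
  have "l \<noteq> 0" using l assms by (cases l) auto
  then have "\<not> t < 2 ^ (l - 1)" using not_less_Least[of "l - 1" "\<lambda>j. t < 2 ^ j"] by (simp add: l_def)
  then show ?thesis using l \<open>l \<noteq> 0\<close> by (intro exI[of _ "l - 1"]) auto
qed

text \<open>If \<open>2 ^ k \<le> infnorm q < 2 ^ Suc k\<close>, monotonicity bounds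
  \<open>\<psi> (infnorm q)\<close> by \<open>\<psi> (2 ^ k)\<close>, so a solution in this dyadic
  block puts the point into \<open>B k\<close>. Borel-Cantelli then applies.\<close>

lemma emeasure_approximable_eq_0:
  fixes A :: "real ^ 'n ^ 'm"
  assumes \<psi>: "\<And>t. 0 < t \<Longrightarrow> 0 < \<psi> t" "antimono_on {0<..} \<psi>"
    and summable: "summable (\<lambda>k. M A (\<psi> (2 ^ k)) (2 ^ k))"
  shows "emeasure lborel (approximable A \<psi> \<inter> unit_cube) = 0"
proof -
  define d where "d = CARD('m) + CARD('n)"
  define B where "B = (\<lambda>k. {x. hits A (\<psi> (2 ^ k)) (2 * 2 ^ k) x \<noteq> {}} \<inter> unit_cube)"
  have [measurable]: "B k \<in> sets borel" for k unfolding B_def by measurable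
  have B: "emeasure lborel (B k) \<le> ennreal (9 ^ d * M A (\<psi> (2 ^ k)) (2 ^ k))" for k
  proof -
    define r where "r = \<psi> (2 ^ k)"
    define T :: real where "T = 2 ^ k"
    have r: "0 < r" unfolding r_def by (intro \<psi>) simp
    have T: "1 \<le> T" by (simp add: T_def)
    have N: "0 < N A r T" by (rule N_pos) (use r T in auto)
    have "of_nat (N A r T) * emeasure lborel (B k) \<le>
        ennreal (real (card (lattice_ball (2 * T + T) :: (real ^ 'n) set)) * (2 * (r + r)) ^ CARD('m))"
      using emeasure_nonempty_hits_le[of r r A T "2 * T"] r by (simp add: B_def r_def T_def)
    also have "\<dots> \<le> ennreal (9 ^ d * (r ^ CARD('m) * T ^ CARD('n)))"
    proof (rule ennreal_leI)
      have "real (card (lattice_ball (2 * T + T) :: (real ^ 'n) set)) * (2 * (r + r)) ^ CARD('m) \<le>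
          (3 * (2 * T + T)) ^ CARD('n) * (9 * r) ^ CARD('m)"
      proof (rule mult_mono)
        show "real (card (lattice_ball (2 * T + T) :: (real ^ 'n) set)) \<le> (3 * (2 * T + T)) ^ CARD('n)"
          using T by (intro card_lattice_ball_bounds(2)) linarith
        show "(2 * (r + r)) ^ CARD('m) \<le> (9 * r) ^ CARD('m)"
          using r by (intro power_mono) auto
      qed (use r T in auto)
      also have "3 * (2 * T + T) = 9 * T" by simp
      also have "(9 * T) ^ CARD('n) * (9 * r) ^ CARD('m) = 9 ^ d * (r ^ CARD('m) * T ^ CARD('n))"
        by (simp only: d_def power_mult_distrib power_add mult_ac)
      finally show "real (card (lattice_ball (2 * T + T) :: (real ^ 'n) set)) * (2 * (r + r)) ^ CARD('m) \<le>
          9 ^ d * (r ^ CARD('m) * T ^ CARD('n))" .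
    qed
    also have "\<dots> = of_nat (N A r T) * ennreal (9 ^ d * M A r T)"
      using N r T by (simp add: M_def ennreal_of_nat_eq_real_of_nat flip: ennreal_mult)
    finally show ?thesis
      using N unfolding r_def T_def
      by (subst (asm) ennreal_mult_le_mult_iff) (auto simp: of_nat_eq_0_iff)
  qed
  have fin: "emeasure lborel (B k) < \<infinity>" for k
    using B[of k] by (simp add: le_less_trans)
  have "AE x in lborel. \<forall>\<^sub>F k in sequentially. x \<in> space lborel - B k"
  proof (rule borel_cantelli_AE1)
    show "summable (\<lambda>k. measure lborel (B k))"
    proof (rule summable_comparison_test)
      show "summable (\<lambda>k. 9 ^ d * M A (\<psi> (2 ^ k)) (2 ^ k))" by (rule summable_mult[OF summable])
      have "measure lborel (B k) \<le> 9 ^ d * M A (\<psi> (2 ^ k)) (2 ^ k)" for k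
        unfolding measure_def using B[of k] M_pos[of "\<psi> (2 ^ k)" "2 ^ k" A] \<psi>(1)
        by (intro enn2real_leI) auto
      then show "\<exists>n. \<forall>k\<ge>n. norm (measure lborel (B k)) \<le> 9 ^ d * M A (\<psi> (2 ^ k)) (2 ^ k)" by simp
    qed
  qed (use fin in auto)
  then have "AE x in lborel. x \<notin> approximable A \<psi> \<inter> unit_cube"
  proof eventually_elim
    case (elim x)
    show ?case
    proof
      assume x: "x \<in> approximable A \<psi> \<inter> unit_cube"
      obtain n where n: "\<And>k. n \<le> k \<Longrightarrow> x \<notin> B k" using elim by (auto simp: eventually_sequentially)
      \<comment> \<open>Choosing \<open>q\<close> beyond \<open>2 ^ n\<close> places its dyadic
        block at an index at least \<open>n\<close>.\<close>
      obtain q where q: "q \<in> int_lattice" "real (2 ^ n) < infnorm q" "lattice_norm (A *v q - x) < \<psi> (infnorm q)"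
        using x mem_approximable_iff[of x A \<psi>] by blast
      have "(1::real) \<le> 2 ^ n" by simp
      also have "2 ^ n < infnorm q" using q(2) by simp
      finally have q1: "1 < infnorm q" .
      then obtain k where k: "2 ^ k \<le> infnorm q" "infnorm q < 2 ^ Suc k"
        using ex_dyadic_interval[of "infnorm q"] less_imp_le by blast
      have "(2::real) ^ n < 2 ^ Suc k" using q(2) k(2) by simp
      then have "n \<le> k" by (simp only: power_strict_increasing_iff)
      obtain p where p: "p \<in> int_lattice" "infnorm (A *v q - x - p) < \<psi> (infnorm q)"
        using q(3) by (auto simp: lattice_norm_less_iff)
      have "\<psi> (infnorm q) \<le> \<psi> (2 ^ k)"
        using \<psi>(2) k(1) q1 by (auto simp: monotone_on_def)
      then have "(p, q) \<in> hits A (\<psi> (2 ^ k)) (2 * 2 ^ k) x"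
        using p q k by (simp add: hits_def algebra_simps)
      then have "x \<in> B k" using x by (auto simp: B_def)
      then show False using n[OF \<open>n \<le> k\<close>] by simp
    qed
  qed
  then show ?thesis
    using approximable_borel[of A \<psi>] by (subst (asm) AE_iff_measurable) auto
qed

text \<open>Almost every \<open>x\<close> has a translate by some \<open>A *v q0 - p0\<close> in the
  limit superior. Undoing the translation replaces \<open>q\<close> by \<open>q - q0\<close>, which
  the halved scales tolerate.\<close>

lemma emeasure_not_approximable_eq_0:
  fixes A :: "real ^ 'n ^ 'm"
  assumes \<psi>: "\<And>t. 0 < t \<Longrightarrow> 0 < \<psi> t" "antimono_on {0<..} \<psi>"
    and reg: "dyadically_regular \<psi>"
    and not_summable: "\<not> summable (\<lambda>k. M A (\<psi> (2 ^ k)) (2 ^ k))"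
  shows "emeasure lborel (- approximable A \<psi>) = 0"
proof -
  obtain \<rho> k0 where \<rho>: "0 < \<rho>" "\<rho> < 1" "\<And>k. k0 \<le> k \<Longrightarrow> \<psi> (2 ^ (k + 1)) \<le> \<rho> * \<psi> (2 ^ k)"
    using reg by (auto simp: dyadically_regular_def)
  \<comment> \<open>The shift by \<open>k0\<close> enters the range of dyadic regularity, and the
    extra 1 keeps \<open>T k = t k / 2\<close> at least 1.\<close>
  define t :: "nat \<Rightarrow> real" where "t = (\<lambda>k. 2 ^ (k + (k0 + 1)))"
  define r where "r = (\<lambda>k. \<psi> (t k) / 2)"
  define T where "T = (\<lambda>k. t k / 2)"
  have t: "0 < t k" for k by (simp add: t_def)
  interpret geometric_scales A r T \<rho>
  proof
    fix k
    show "0 < r k" unfolding r_def using \<psi>(1)[OF t] by simp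
    show "r (Suc k) \<le> \<rho> * r k" using \<rho>(3)[of "k + (k0 + 1)"] by (simp add: r_def t_def)
    show "1 \<le> T k" by (simp add: T_def t_def)
    show "T (Suc k) = 2 * T k" by (simp add: T_def t_def)
  qed (use \<rho> in auto)
  have "\<not> summable m"
  proof
    assume "summable m"
    then have "summable (\<lambda>k. 2 ^ (CARD('m) + CARD('n)) * m k)" by (rule summable_mult)
    moreover have "norm (M A (\<psi> (t k)) (t k)) \<le> 2 ^ (CARD('m) + CARD('n)) * m k" for k
    proof -
      \<comment> \<open>Halving both sizes can only lower the count, so \<open>M\<close> at the
        original scale is at most \<open>2 ^ (CARD('m) + CARD('n))\<close> times
        \<open>m k\<close>.\<close>
      have "real (N A (r k) (T k)) \<le> real (N A (\<psi> (t k)) (t k))"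
        using \<psi>(1)[OF t[of k]] t[of k] by (auto simp: r_def T_def intro!: N_mono)
      then have "\<psi> (t k) ^ CARD('m) * t k ^ CARD('n) / real (N A (\<psi> (t k)) (t k)) \<le>
          \<psi> (t k) ^ CARD('m) * t k ^ CARD('n) / real (N A (r k) (T k))"
        using \<psi>(1)[OF t[of k]] t[of k] N_gt_0[of k k] by (intro divide_left_mono) auto
      also have "\<dots> = 2 ^ (CARD('m) + CARD('n)) * m k"
        by (simp add: M_def r_def T_def power_divide power_add)
      finally show ?thesis
        using \<psi>(1)[OF t[of k]] t[of k] by (simp add: M_def)
    qed
    ultimately have "summable (\<lambda>k. M A (\<psi> (t k)) (t k))"
      by (rule summable_comparison_test'[where N = 0])
    then show False
      using not_summable summable_iff_shift[of "\<lambda>k. M A (\<psi> (2 ^ k)) (2 ^ k)" "k0 + 1"] by (simp add: t_def)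
  qed
  define L where "L = (\<Inter>n. \<Union>k\<in>{n..}. E k)"
  define \<Omega> where "\<Omega> = (\<Union>z\<in>int_lattice \<times> int_lattice. {x. A *v snd z - fst z + x \<in> L})"
  \<comment> \<open>The countable set of points hit exactly. On it, one fixed \<open>q\<close> may
    account for hits at all scales, so it is discarded as a null set.\<close>
  define G where "G = (\<lambda>z. A *v snd z - fst z) ` (int_lattice \<times> int_lattice)"
  have [measurable]: "L \<in> sets borel" unfolding L_def by measurable
  have \<Omega>: "\<Omega> \<in> sets borel"
    unfolding \<Omega>_def by (intro sets.countable_UN' countable_SIGMA countable_int_lattice) auto
  have "- \<Omega> \<in> null_sets lborel"
  proof (rule null_setsI)
    show "emeasure lborel (- \<Omega>) = 0"
      unfolding \<Omega>_def L_def by (rule emeasure_orbit_limsup_compl[OF \<open>\<not> summable m\<close>])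
  qed (use \<Omega> in auto)
  moreover have "G \<in> null_sets lborel"
    unfolding G_def by (intro countable_imp_null_set_lborel countable_image countable_SIGMA countable_int_lattice)
  ultimately have "- \<Omega> \<union> G \<in> null_sets lborel" by (rule null_sets.Un)
  moreover have "- approximable A \<psi> \<subseteq> - \<Omega> \<union> G"
  proof -
    have "x \<in> approximable A \<psi>" if x: "x \<in> \<Omega>" "x \<notin> G" for x
      unfolding mem_approximable_iff
    proof
      fix n :: nat
      obtain p0 q0 where pq0: "p0 \<in> int_lattice" "q0 \<in> int_lattice" "A *v q0 - p0 + x \<in> L"
        using x by (auto simp: \<Omega>_def)
      define F where "F = {q \<in> int_lattice. infnorm (q :: real ^ 'n) \<le> real n}"
      have "finite F" unfolding F_def by (rule finite_int_lattice_ball)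
      have F0: "0 \<in> F" by (simp add: F_def infnorm_0)
      have pos: "0 < lattice_norm (A *v q - x)" if "q \<in> F" for q
      proof -
        obtain p where p: "p \<in> int_lattice" "lattice_norm (A *v q - x) = infnorm (A *v q - x - p)"
          using lattice_norm_attained by blast
        have "A *v q - x - p \<noteq> 0"
        proof
          assume "A *v q - x - p = 0"
          then have "x = A *v q - p" by (simp add: algebra_simps)
          then have "x \<in> G" using p that unfolding G_def F_def by (intro image_eqI[of _ _ "(p, q)"]) auto
          then show False using x by simp
        qed
        then show ?thesis using p by (simp add: infnorm_pos_lt)
      qed
      \<comment> \<open>The best approximation to \<open>x\<close> among the finitely many
        \<open>q\<close> with norm at most \<open>n\<close>, positive because
        \<open>x \<notin> G\<close>. Once \<open>r k < \<delta>\<close>, the solution found must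
        have larger norm.\<close>
      define \<delta> where "\<delta> = Min ((\<lambda>q. lattice_norm (A *v q - x)) ` F)"
      have \<delta>: "0 < \<delta>" unfolding \<delta>_def using \<open>finite F\<close> F0 pos by (subst Min_gr_iff) auto
      have \<delta>_le: "\<delta> \<le> lattice_norm (A *v q - x)" if "q \<in> F" for q
        unfolding \<delta>_def using \<open>finite F\<close> that by (intro Min_le) auto
      obtain k1 where k1: "\<And>k. k1 \<le> k \<Longrightarrow> r k < \<delta>"
        using order_tendstoD(2)[OF r_tendsto_0 \<delta>] by (auto simp: eventually_sequentially)
      \<comment> \<open>From here on \<open>infnorm q0 \<le> T k\<close>, so \<open>q - q0\<close>
        has norm at most \<open>2 * T k = t k\<close>.\<close>
      obtain k2 where k2: "infnorm q0 < 2 ^ k2" using real_arch_pow[of 2 "infnorm q0"] by auto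
      obtain k where k: "max k1 k2 \<le> k" "A *v q0 - p0 + x \<in> E k"
        using pq0(3) unfolding L_def by (metis (no_types, lifting) INT_E UN_E UNIV_I atLeast_iff)
      have Tk: "infnorm q0 \<le> T k"
      proof -
        have "(2::real) ^ k2 \<le> 2 ^ (k + k0)" using k by (intro power_increasing) auto
        then have "infnorm q0 \<le> 2 ^ (k + k0)" using k2 by linarith
        then show ?thesis by (simp add: T_def t_def)
      qed
      obtain p q where pq: "(p, q) \<in> hits A (r k) (T k) (A *v q0 - p0 + x)" using k by auto
      define q' where "q' = q - q0"
      have q': "q' \<in> int_lattice" "p - p0 \<in> int_lattice"
        using pq pq0 by (auto simp: q'_def hits_def intro: int_lattice_diff)
      have eq: "A *v q' - x - (p - p0) = A *v q - p - (A *v q0 - p0 + x)"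
        by (simp add: q'_def matrix_vector_mult_diff_distrib)
      have "infnorm (A *v q' - x - (p - p0)) \<le> r k" unfolding eq using pq by (simp add: hits_def)
      then have ln: "lattice_norm (A *v q' - x) \<le> r k" using lattice_norm_le[OF q'(2)] order_trans by blast
      have "q' \<notin> F" using \<delta>_le[of q'] ln k1[of k] k by fastforce
      then have n: "real n < infnorm q'" using q' by (simp add: F_def)
      have "infnorm q' \<le> infnorm q + infnorm q0"
        using infnorm_triangle[of q "- q0"] by (simp add: q'_def infnorm_neg)
      also have "\<dots> \<le> t k" using pq Tk by (auto simp: hits_def T_def)
      finally have "\<psi> (t k) \<le> \<psi> (infnorm q')"
        using \<psi>(2) n t[of k] by (auto simp: monotone_on_def)
      \<comment> \<open>Halving \<open>\<psi>\<close> turns the non-strict inequality in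
        \<open>hits\<close> into the required strict one.\<close>
      moreover have "r k < \<psi> (t k)" using \<psi>(1)[OF t[of k]] by (simp add: r_def)
      ultimately show "\<exists>q\<in>int_lattice. real n < infnorm q \<and> lattice_norm (A *v q - x) < \<psi> (infnorm q)"
        using q' n ln by force
    qed
    then show ?thesis by auto
  qed
  ultimately have "- approximable A \<psi> \<in> null_sets lborel"
    using approximable_borel[of A \<psi>] by (metis null_sets_subset sets.compl_sets Compl_eq_Diff_UNIV sets_lborel space_lborel space_borel)
  then show ?thesis by auto
qed

theorem theorem1p1:
  fixes A :: "real ^ 'n ^ 'm" and \<psi> :: "real \<Rightarrow> real"
  assumes "\<And>t. t > 0 \<Longrightarrow> \<psi> t > 0"
    and "antimono_on {0<..} \<psi>"
    and "dyadically_regular \<psi>"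
  shows "W A \<psi> \<in> sets torus_measure \<and>
    ((\<Sum>k. ennreal (M A (\<psi> (2 ^ k)) (2 ^ k))) < \<infinity> \<longrightarrow>
       emeasure torus_measure (W A \<psi>) = 0) \<and>
    ((\<Sum>k. ennreal (M A (\<psi> (2 ^ k)) (2 ^ k))) = \<infinity> \<longrightarrow>
       emeasure torus_measure (W A \<psi>) = 1)"
proof (intro conjI impI emeasure_W(1))
  have M0: "0 \<le> M A (\<psi> (2 ^ k)) (2 ^ k)" for k
    using assms(1) by (intro less_imp_le[OF M_pos]) auto
  note [measurable] = approximable_borel[of A \<psi>]
  {
    assume "(\<Sum>k. ennreal (M A (\<psi> (2 ^ k)) (2 ^ k))) < \<infinity>"
    then have "summable (\<lambda>k. M A (\<psi> (2 ^ k)) (2 ^ k))"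
      using M0 by (intro summable_suminf_not_top) auto
    then have "approximable A \<psi> \<inter> unit_cube \<in> null_sets lborel"
      using emeasure_approximable_eq_0[OF assms(1,2)] by (intro null_setsI) auto
    \<comment> \<open>The torus measure uses the closed cube and the moment estimates the half-open
      one; they differ by a null set.\<close>
    moreover have "cbox 0 1 - (unit_cube :: (real ^ 'm) set) \<in> null_sets lborel"
    proof (rule null_setsI)
      have "(unit_cube :: (real ^ 'm) set) \<subseteq> cbox 0 1"
        by (auto simp: unit_cube_def mem_box_cart less_imp_le)
      then show "emeasure lborel (cbox 0 1 - (unit_cube :: (real ^ 'm) set)) = 0"
        by (subst emeasure_Diff) (auto simp: emeasure_unit_cube emeasure_cbox_0_1)
    qed auto
    ultimately have "approximable A \<psi> \<inter> unit_cube \<union> (cbox 0 1 - unit_cube) \<in> null_sets lborel"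
      by (rule null_sets.Un)
    then have "approximable A \<psi> \<inter> cbox 0 1 \<in> null_sets lborel"
      by (rule null_sets_subset) auto
    then show "emeasure torus_measure (W A \<psi>) = 0" by (simp add: emeasure_W null_setsD1)
  next
    assume inf: "(\<Sum>k. ennreal (M A (\<psi> (2 ^ k)) (2 ^ k))) = \<infinity>"
    have "\<not> summable (\<lambda>k. M A (\<psi> (2 ^ k)) (2 ^ k))"
      using inf M0 by (auto simp: suminf_ennreal2)
    then have "- approximable A \<psi> \<in> null_sets lborel"
      using emeasure_not_approximable_eq_0[OF assms] by (intro null_setsI) auto
    then have "emeasure lborel (cbox 0 1 - - approximable A \<psi>) = 1"
      by (subst emeasure_Diff_null_set) (auto simp: emeasure_cbox_0_1)
    moreover have "cbox 0 1 - - approximable A \<psi> = approximable A \<psi> \<inter> cbox 0 1" by auto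
    ultimately show "emeasure torus_measure (W A \<psi>) = 1" by (simp add: emeasure_W)
  }
qed

end
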